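(* The following MV-algebras are not hopfian: (i) free MV-algebras over infinitely many free generators; (ii) the free product $\mathrm C\amalg\mathrm C$, where $\mathrm C$ is the Chang algebra; (iii) all countably infinite boolean algebras.
   Context: An MV-algebra is an abelian monoid $(A,0,\oplus)$ with a unary operation $\neg$ satisfying $\neg\neg x=x$, $x\oplus\neg 0=\neg 0$ and $\neg(\neg x\oplus y)\oplus y=\neg(\neg y\oplus x)\oplus x$. Boolean algebras are identified with the MV-algebras satisfying $x\oplus x=x$. For a unital $\ell$-group $(G,u)$ (an abelian lattice-ordered group with a unit $u\ge 0$ some multiple of which dominates any given element), $\Gamma(G,u)$ is the MV-algebra $([0,u],0,\neg,\oplus)$ with $\neg x=u-x$, $x\oplus y=\min(u,x+y)$. The Chang algebra is $\mathrm C=\Gamma(\mathbb Z\times_{\rm lex}\mathbb Z,(1,0))=\{0,\epsilon,2\epsilon,\ldots,1-2\epsilon,1-\epsilon,1\}$, where $\mathbb Z\times_{\rm lex}\mathbb Z$ is $\mathbb Z^2$ with the lexicographic order (first coordinate dominant). $\amalg$ denotes the free product (coproduct) in the category of MV-algebras. $A$ is hopfian if every homomorphism of $A$ onto $A$ is an automorphism. *)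

theory Defs
  imports "HOL-Library.Lattice_Algebras" "HOL-Library.Countable_Set"
begin

section \<open>MV-algebras, homomorphisms, hopfian algebras\<close>

record 'a mv =
  mv_carrier :: "'a set"
  mv_zero :: 'a
  mv_neg :: "'a \<Rightarrow> 'a"
  mv_plus :: "'a \<Rightarrow> 'a \<Rightarrow> 'a"

locale mv_algebra =
  fixes A :: "'a mv"
  assumes zero_closed: "mv_zero A \<in> mv_carrier A"
    and neg_closed: "x \<in> mv_carrier A \<Longrightarrow> mv_neg A x \<in> mv_carrier A"
    and plus_closed: "\<lbrakk>x \<in> mv_carrier A; y \<in> mv_carrier A\<rbrakk> \<Longrightarrow> mv_plus A x y \<in> mv_carrier A"
    and plus_assoc: "\<lbrakk>x \<in> mv_carrier A; y \<in> mv_carrier A; z \<in> mv_carrier A\<rbrakk> \<Longrightarrow>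
      mv_plus A (mv_plus A x y) z = mv_plus A x (mv_plus A y z)"
    and plus_comm: "\<lbrakk>x \<in> mv_carrier A; y \<in> mv_carrier A\<rbrakk> \<Longrightarrow> mv_plus A x y = mv_plus A y x"
    and plus_zero: "x \<in> mv_carrier A \<Longrightarrow> mv_plus A x (mv_zero A) = x"
    and neg_neg: "x \<in> mv_carrier A \<Longrightarrow> mv_neg A (mv_neg A x) = x"
    and plus_top: "x \<in> mv_carrier A \<Longrightarrow>
      mv_plus A x (mv_neg A (mv_zero A)) = mv_neg A (mv_zero A)"
    and lukasiewicz: "\<lbrakk>x \<in> mv_carrier A; y \<in> mv_carrier A\<rbrakk> \<Longrightarrow>
      mv_plus A (mv_neg A (mv_plus A (mv_neg A x) y)) y =
      mv_plus A (mv_neg A (mv_plus A (mv_neg A y) x)) x"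

locale boolean_mv_algebra = mv_algebra +
  assumes plus_idem: "x \<in> mv_carrier A \<Longrightarrow> mv_plus A x x = x"

definition mv_hom :: "'a mv \<Rightarrow> 'b mv \<Rightarrow> ('a \<Rightarrow> 'b) set" where
  "mv_hom A B = {h. h ` mv_carrier A \<subseteq> mv_carrier B \<and>
     h (mv_zero A) = mv_zero B \<and>
     (\<forall>x\<in>mv_carrier A. h (mv_neg A x) = mv_neg B (h x)) \<and>
     (\<forall>x\<in>mv_carrier A. \<forall>y\<in>mv_carrier A. h (mv_plus A x y) = mv_plus B (h x) (h y))}"

definition mv_iso :: "'a mv \<Rightarrow> 'b mv \<Rightarrow> ('a \<Rightarrow> 'b) set" where
  "mv_iso A B = {h \<in> mv_hom A B. bij_betw h (mv_carrier A) (mv_carrier B)}"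

definition mv_isomorphic :: "'a mv \<Rightarrow> 'b mv \<Rightarrow> bool" where
  "mv_isomorphic A B \<longleftrightarrow> mv_iso A B \<noteq> {}"

definition hopfian :: "'a mv \<Rightarrow> bool" where
  "hopfian A \<longleftrightarrow>
     (\<forall>h \<in> mv_hom A A. h ` mv_carrier A = mv_carrier A \<longrightarrow> h \<in> mv_iso A A)"


section \<open>Unital lattice-ordered groups and the Chang algebra\<close>

definition strong_unit :: "'g :: lattice_ab_group_add \<Rightarrow> bool" where
  "strong_unit u \<longleftrightarrow> 0 \<le> u \<and> (\<forall>x. \<exists>n::nat. x \<le> ((\<lambda>y. u + y) ^^ n) 0)"

definition mv_Gamma :: "'g :: lattice_ab_group_add \<Rightarrow> 'g mv" where
  "mv_Gamma u = \<lparr>mv_carrier = {0..u}, mv_zero = 0, mv_neg = (\<lambda>x. u - x),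
                 mv_plus = (\<lambda>x y. inf u (x + y))\<rparr>"

lemma mv_algebra_Gamma:
  fixes u :: "'g :: lattice_ab_group_add"
  assumes "strong_unit u"
  shows "mv_algebra (mv_Gamma u)"
proof -
  have u0: "0 \<le> u" using assms by (simp add: strong_unit_def)
  have luk: "inf u (u - inf u (u - x + y) + y) = sup x y"
    if "0 \<le> x" "x \<le> u" "0 \<le> y" "y \<le> u" for x y :: 'g
  proof -
    have "inf u (u - x + y) = u + inf 0 (y - x)"
      by (simp add: add_inf_distrib_left algebra_simps)
    then have "u - inf u (u - x + y) = sup 0 (x - y)"
      by (simp add: neg_inf_eq_sup algebra_simps)
    then have "u - inf u (u - x + y) + y = sup y x"
      by (simp add: add_sup_distrib_right)
    then show ?thesis using that by (simp add: inf_absorb2 sup_commute)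
  qed
  have assoc: "inf u (inf u (x + y) + z) = inf u (x + y + z)" if "0 \<le> z" for x y z :: 'g
  proof -
    have "inf u (inf u (x + y) + z) = inf (inf u (u + z)) (x + y + z)"
      by (simp add: add_inf_distrib_right inf_assoc)
    also have "inf u (u + z) = u" using that by (simp add: inf_absorb1)
    finally show ?thesis .
  qed
  show ?thesis
  proof (unfold_locales, goal_cases)
    case (4 x y z)
    then have "inf u (inf u (x + y) + z) = inf u (x + y + z)"
      "inf u (inf u (y + z) + x) = inf u (y + z + x)"
      by (auto simp: mv_Gamma_def intro: assoc)
    then show ?case by (simp add: mv_Gamma_def ac_simps)
  next
    case (9 x y)
    then show ?case using luk[of x y] luk[of y x] by (simp add: mv_Gamma_def sup_commute)
  qed (use u0 in \<open>auto simp: mv_Gamma_def ac_simps inf_absorb1 inf_absorb2\<close>)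
qed

text \<open>A separate type of pairs carries the lexicographic order, so that no order is imposed on
  the ordinary product type.\<close>

datatype ('a, 'b) lex = Lex 'a 'b

instantiation lex :: (ab_group_add, ab_group_add) ab_group_add
begin

definition zero_lex :: "('a, 'b) lex" where "0 = Lex 0 0"

fun plus_lex :: "('a, 'b) lex \<Rightarrow> ('a, 'b) lex \<Rightarrow> ('a, 'b) lex" where
  "Lex a b + Lex c d = Lex (a + c) (b + d)"

fun minus_lex :: "('a, 'b) lex \<Rightarrow> ('a, 'b) lex \<Rightarrow> ('a, 'b) lex" where
  "Lex a b - Lex c d = Lex (a - c) (b - d)"

fun uminus_lex :: "('a, 'b) lex \<Rightarrow> ('a, 'b) lex" where
  "- Lex a b = Lex (- a) (- b)"

instance
proof (standard, goal_cases)
  case (1 a b c)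
  then show ?case by (cases a; cases b; cases c) (simp add: ac_simps)
next
  case (2 a b)
  then show ?case by (cases a; cases b) (simp add: ac_simps)
next
  case (3 a)
  then show ?case by (cases a) (simp add: zero_lex_def)
next
  case (4 a)
  then show ?case by (cases a) (simp add: zero_lex_def)
next
  case (5 a b)
  then show ?case by (cases a; cases b) simp
qed

end

instantiation lex :: (linorder, linorder) linorder
begin

fun less_eq_lex :: "('a, 'b) lex \<Rightarrow> ('a, 'b) lex \<Rightarrow> bool" where
  "Lex a b \<le> Lex c d \<longleftrightarrow> a < c \<or> (a = c \<and> b \<le> d)"

fun less_lex :: "('a, 'b) lex \<Rightarrow> ('a, 'b) lex \<Rightarrow> bool" where
  "Lex a b < Lex c d \<longleftrightarrow> a < c \<or> (a = c \<and> b < d)"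

instance
proof (standard, goal_cases)
  case (1 x y)
  then show ?case by (cases x; cases y) auto
next
  case (2 x)
  then show ?case by (cases x) auto
next
  case (3 x y z)
  then show ?case by (cases x; cases y; cases z) auto
next
  case (4 x y)
  then show ?case by (cases x; cases y) auto
next
  case (5 x y)
  then show ?case by (cases x; cases y) auto
qed

end

instantiation lex :: (linorder, linorder) lattice
begin

definition inf_lex :: "('a, 'b) lex \<Rightarrow> ('a, 'b) lex \<Rightarrow> ('a, 'b) lex" where
  "inf_lex = min"

definition sup_lex :: "('a, 'b) lex \<Rightarrow> ('a, 'b) lex \<Rightarrow> ('a, 'b) lex" where
  "sup_lex = max"

instance
  by standard (auto simp: inf_lex_def sup_lex_def)

end

instance lex :: (linordered_ab_group_add, linordered_ab_group_add) linordered_ab_group_add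
proof
  fix x y z :: "('a, 'b) lex"
  assume "x \<le> y"
  then show "z + x \<le> z + y" by (cases x; cases y; cases z) auto
qed

instance lex :: (linordered_ab_group_add, linordered_ab_group_add) lattice_ab_group_add ..

lemma strong_unit_Lex_1_0: "strong_unit (Lex 1 0 :: (int, int) lex)"
proof -
  have mult: "((\<lambda>y. Lex 1 0 + y) ^^ n) 0 = (Lex (int n) 0 :: (int, int) lex)" for n
    by (induction n) (simp_all add: zero_lex_def)
  have "\<exists>n. x \<le> ((\<lambda>y. Lex 1 0 + y) ^^ n) 0" for x :: "(int, int) lex"
  proof (cases x)
    case (Lex a b)
    then have "x \<le> Lex (int (nat (a + 1))) 0" by simp
    then show ?thesis using mult by metis
  qed
  then show ?thesis by (simp add: strong_unit_def zero_lex_def)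
qed

definition Chang :: "(int, int) lex mv" where
  "Chang = mv_Gamma (Lex 1 0)"

lemma mv_algebra_Chang: "mv_algebra Chang"
  unfolding Chang_def by (rule mv_algebra_Gamma[OF strong_unit_Lex_1_0])


section \<open>Presented MV-algebras\<close>

datatype 'x mv_term = Var 'x | Zero | Neg "'x mv_term" | Plus "'x mv_term" "'x mv_term"

definition mv_terms :: "'x set \<Rightarrow> 'x mv_term set" where
  "mv_terms X = {t. set_mv_term t \<subseteq> X}"

text \<open>The least congruence on the terms over \<open>X\<close> that contains \<open>R\<close> and has a quotient satisfying
  the MV-algebra equations.\<close>

inductive mv_eq :: "'x set \<Rightarrow> ('x mv_term \<times> 'x mv_term) set \<Rightarrow> 'x mv_term \<Rightarrow> 'x mv_term \<Rightarrow> bool"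
  for X R where
  rel: "(s, t) \<in> R \<Longrightarrow> s \<in> mv_terms X \<Longrightarrow> t \<in> mv_terms X \<Longrightarrow> mv_eq X R s t"
| refl: "s \<in> mv_terms X \<Longrightarrow> mv_eq X R s s"
| sym: "mv_eq X R s t \<Longrightarrow> mv_eq X R t s"
| trans: "mv_eq X R s t \<Longrightarrow> mv_eq X R t r \<Longrightarrow> mv_eq X R s r"
| neg: "mv_eq X R s t \<Longrightarrow> mv_eq X R (Neg s) (Neg t)"
| plus: "mv_eq X R s s' \<Longrightarrow> mv_eq X R t t' \<Longrightarrow> mv_eq X R (Plus s t) (Plus s' t')"
| assoc: "s \<in> mv_terms X \<Longrightarrow> t \<in> mv_terms X \<Longrightarrow> r \<in> mv_terms X \<Longrightarrow>
    mv_eq X R (Plus (Plus s t) r) (Plus s (Plus t r))"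
| comm: "s \<in> mv_terms X \<Longrightarrow> t \<in> mv_terms X \<Longrightarrow> mv_eq X R (Plus s t) (Plus t s)"
| unit: "s \<in> mv_terms X \<Longrightarrow> mv_eq X R (Plus s Zero) s"
| neg_neg: "s \<in> mv_terms X \<Longrightarrow> mv_eq X R (Neg (Neg s)) s"
| top: "s \<in> mv_terms X \<Longrightarrow> mv_eq X R (Plus s (Neg Zero)) (Neg Zero)"
| luk: "s \<in> mv_terms X \<Longrightarrow> t \<in> mv_terms X \<Longrightarrow>
    mv_eq X R (Plus (Neg (Plus (Neg s) t)) t) (Plus (Neg (Plus (Neg t) s)) s)"

definition mv_class :: "'x set \<Rightarrow> ('x mv_term \<times> 'x mv_term) set \<Rightarrow> 'x mv_term \<Rightarrow> 'x mv_term set" where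
  "mv_class X R s = {t. mv_eq X R s t}"

definition mv_presented ::
  "'x set \<Rightarrow> ('x mv_term \<times> 'x mv_term) set \<Rightarrow> 'x mv_term set mv" where
  "mv_presented X R =
     \<lparr>mv_carrier = mv_class X R ` mv_terms X,
      mv_zero = mv_class X R Zero,
      mv_neg = (\<lambda>a. \<Union>s\<in>a. mv_class X R (Neg s)),
      mv_plus = (\<lambda>a b. \<Union>s\<in>a. \<Union>t\<in>b. mv_class X R (Plus s t))\<rparr>"

lemma mv_terms_simps [simp]:
  "Var x \<in> mv_terms X \<longleftrightarrow> x \<in> X"
  "Zero \<in> mv_terms X"
  "Neg s \<in> mv_terms X \<longleftrightarrow> s \<in> mv_terms X"
  "Plus s t \<in> mv_terms X \<longleftrightarrow> s \<in> mv_terms X \<and> t \<in> mv_terms X"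
  by (auto simp: mv_terms_def)

lemma mv_eq_terms: "mv_eq X R s t \<Longrightarrow> s \<in> mv_terms X \<and> t \<in> mv_terms X"
  by (induction rule: mv_eq.induct) auto

lemma mv_class_eq: "mv_eq X R s t \<Longrightarrow> mv_class X R s = mv_class X R t"
  unfolding mv_class_def by (blast intro: mv_eq.sym mv_eq.trans)

lemma mv_class_eq_iff:
  "s \<in> mv_terms X \<Longrightarrow> mv_class X R s = mv_class X R t \<longleftrightarrow> mv_eq X R s t"
  by (metis mv_class_eq mv_class_def mem_Collect_eq mv_eq.refl mv_eq.sym mv_eq_terms)

lemma mv_presented_simps:
  "mv_carrier (mv_presented X R) = mv_class X R ` mv_terms X"
  "mv_zero (mv_presented X R) = mv_class X R Zero"
  "s \<in> mv_terms X \<Longrightarrow> mv_neg (mv_presented X R) (mv_class X R s) = mv_class X R (Neg s)"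
  "s \<in> mv_terms X \<Longrightarrow> t \<in> mv_terms X \<Longrightarrow>
    mv_plus (mv_presented X R) (mv_class X R s) (mv_class X R t) = mv_class X R (Plus s t)"
proof -
  have self: "s \<in> mv_class X R s" if "s \<in> mv_terms X" for s
    using that by (simp add: mv_class_def mv_eq.refl)
  have mem: "mv_eq X R s' s" if "s' \<in> mv_class X R s" for s s'
    using that by (simp add: mv_class_def mv_eq.sym)
  assume s: "s \<in> mv_terms X"
  have "mv_class X R (Neg s') = mv_class X R (Neg s)" if "s' \<in> mv_class X R s" for s'
    using mem[OF that] by (intro mv_class_eq mv_eq.neg)
  then have "(\<Union>s'\<in>mv_class X R s. mv_class X R (Neg s')) = mv_class X R (Neg s)"
    using self[OF s] by blast
  then show "mv_neg (mv_presented X R) (mv_class X R s) = mv_class X R (Neg s)"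
    by (simp add: mv_presented_def)
  assume t: "t \<in> mv_terms X"
  have "mv_class X R (Plus s' t') = mv_class X R (Plus s t)"
    if "s' \<in> mv_class X R s" "t' \<in> mv_class X R t" for s' t'
    using mem[OF that(1)] mem[OF that(2)] by (intro mv_class_eq mv_eq.plus)
  then have "(\<Union>s'\<in>mv_class X R s. \<Union>t'\<in>mv_class X R t. mv_class X R (Plus s' t')) =
      mv_class X R (Plus s t)"
    using self[OF s] self[OF t] by blast
  then show "mv_plus (mv_presented X R) (mv_class X R s) (mv_class X R t) = mv_class X R (Plus s t)"
    by (simp add: mv_presented_def)
qed (simp_all add: mv_presented_def)

lemma mv_class_in_presented:
  "s \<in> mv_terms X \<Longrightarrow> mv_class X R s \<in> mv_carrier (mv_presented X R)"
  by (simp add: mv_presented_simps)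

lemma mv_presented_cases:
  assumes "a \<in> mv_carrier (mv_presented X R)"
  obtains s where "s \<in> mv_terms X" "a = mv_class X R s"
  using assms by (auto simp: mv_presented_simps)

lemma mv_algebra_presented: "mv_algebra (mv_presented X R)"
  apply (rule mv_algebra.intro)
  subgoal by ((elim mv_presented_cases)?; hypsubst?; simp add: mv_class_in_presented mv_presented_simps(2-4))
  subgoal by ((elim mv_presented_cases)?; hypsubst?; simp add: mv_class_in_presented mv_presented_simps(2-4))
  subgoal by ((elim mv_presented_cases)?; hypsubst?; simp add: mv_class_in_presented mv_presented_simps(2-4))
  subgoal by ((elim mv_presented_cases)?; hypsubst?; simp add: mv_presented_simps(2-4) mv_class_eq_iff mv_eq.assoc)
  subgoal by ((elim mv_presented_cases)?; hypsubst?; simp add: mv_presented_simps(2-4) mv_class_eq_iff mv_eq.comm)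
  subgoal by ((elim mv_presented_cases)?; hypsubst?; simp add: mv_presented_simps(2-4) mv_class_eq_iff mv_eq.unit)
  subgoal by ((elim mv_presented_cases)?; hypsubst?; simp add: mv_presented_simps(2-4) mv_class_eq_iff mv_eq.neg_neg)
  subgoal by ((elim mv_presented_cases)?; hypsubst?; simp add: mv_presented_simps(2-4) mv_class_eq_iff mv_eq.top)
  subgoal by ((elim mv_presented_cases)?; hypsubst?; simp add: mv_presented_simps(2-4) mv_class_eq_iff mv_eq.luk)
  done

primrec mv_eval :: "'a mv \<Rightarrow> ('x \<Rightarrow> 'a) \<Rightarrow> 'x mv_term \<Rightarrow> 'a" where
  "mv_eval A f (Var x) = f x"
| "mv_eval A f Zero = mv_zero A"
| "mv_eval A f (Neg s) = mv_neg A (mv_eval A f s)"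
| "mv_eval A f (Plus s t) = mv_plus A (mv_eval A f s) (mv_eval A f t)"

lemma (in mv_algebra) mv_eval_closed:
  assumes "f ` X \<subseteq> mv_carrier A" and "t \<in> mv_terms X"
  shows "mv_eval A f t \<in> mv_carrier A"
  using assms(2) by (induction t) (use assms(1) in \<open>auto intro: zero_closed neg_closed plus_closed\<close>)

lemma (in mv_algebra) mv_eval_eq:
  assumes f: "f ` X \<subseteq> mv_carrier A"
    and R: "\<And>s t. (s, t) \<in> R \<Longrightarrow> s \<in> mv_terms X \<Longrightarrow> t \<in> mv_terms X \<Longrightarrow> mv_eval A f s = mv_eval A f t"
    and "mv_eq X R s t"
  shows "mv_eval A f s = mv_eval A f t"
  using assms(3)
proof (induction rule: mv_eq.induct)
  case (rel s t)
  then show ?case by (rule R)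
qed (simp_all add: mv_eval_closed[OF f] plus_assoc plus_zero neg_neg plus_top lukasiewicz
       plus_comm)

lemma mv_presented_universal:
  fixes B :: "'b mv"
  assumes B: "mv_algebra B" and f: "f ` X \<subseteq> mv_carrier B"
    and R: "\<And>s t. (s, t) \<in> R \<Longrightarrow> s \<in> mv_terms X \<Longrightarrow> t \<in> mv_terms X \<Longrightarrow> mv_eval B f s = mv_eval B f t"
  shows "\<exists>h \<in> mv_hom (mv_presented X R) B. \<forall>x\<in>X. h (mv_class X R (Var x)) = f x"
proof -
  interpret B: mv_algebra B by (rule B)
  define h where "h a = mv_eval B f (SOME s. s \<in> a)" for a
  have h: "h (mv_class X R s) = mv_eval B f s" if "s \<in> mv_terms X" for s
  proof -
    have "s \<in> mv_class X R s" using that by (simp add: mv_class_def mv_eq.refl)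
    then have "(SOME t. t \<in> mv_class X R s) \<in> mv_class X R s" by (rule someI)
    then have "mv_eq X R s (SOME t. t \<in> mv_class X R s)" by (simp add: mv_class_def)
    from B.mv_eval_eq[OF f R this] show ?thesis by (simp add: h_def)
  qed
  have "h \<in> mv_hom (mv_presented X R) B"
    by (auto simp: mv_hom_def mv_presented_simps h B.mv_eval_closed[OF f])
  moreover have "\<forall>x\<in>X. h (mv_class X R (Var x)) = f x" by (simp add: h)
  ultimately show ?thesis by blast
qed

lemma mv_presented_unique:
  assumes "g \<in> mv_hom (mv_presented X R) B" "h \<in> mv_hom (mv_presented X R) B"
    and "\<And>x. x \<in> X \<Longrightarrow> g (mv_class X R (Var x)) = h (mv_class X R (Var x))"
    and "a \<in> mv_carrier (mv_presented X R)"
  shows "g a = h a"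
proof -
  let ?P = "mv_presented X R"
  have zero: "k (mv_class X R Zero) = mv_zero B" if "k \<in> mv_hom ?P B" for k
    using that by (simp add: mv_hom_def mv_presented_simps(2))
  have neg: "k (mv_class X R (Neg s)) = mv_neg B (k (mv_class X R s))"
    if "k \<in> mv_hom ?P B" "s \<in> mv_terms X" for k s
  proof -
    have "k (mv_neg ?P (mv_class X R s)) = mv_neg B (k (mv_class X R s))"
      using that(1) mv_class_in_presented[OF that(2)] by (simp add: mv_hom_def)
    then show ?thesis by (simp only: mv_presented_simps(3)[OF that(2)])
  qed
  have plus: "k (mv_class X R (Plus s t)) = mv_plus B (k (mv_class X R s)) (k (mv_class X R t))"
    if "k \<in> mv_hom ?P B" "s \<in> mv_terms X" "t \<in> mv_terms X" for k s t
  proof -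
    have "k (mv_plus ?P (mv_class X R s) (mv_class X R t)) =
        mv_plus B (k (mv_class X R s)) (k (mv_class X R t))"
      using that(1) mv_class_in_presented[OF that(2)] mv_class_in_presented[OF that(3)] by (simp add: mv_hom_def)
    then show ?thesis by (simp only: mv_presented_simps(4)[OF that(2,3)])
  qed
  have "g (mv_class X R s) = h (mv_class X R s)" if "s \<in> mv_terms X" for s
    using that
    by (induction s)
      (simp_all add: assms(3) zero[OF assms(1)] zero[OF assms(2)] neg[OF assms(1)] neg[OF assms(2)]
        plus[OF assms(1)] plus[OF assms(2)])
  then show ?thesis using assms(4) by (auto simp: mv_presented_simps)
qed


section \<open>Free MV-algebras and free products\<close>

definition mv_free :: "'x set \<Rightarrow> 'x mv_term set mv" where
  "mv_free X = mv_presented X {}"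

definition mv_free_gen :: "'x set \<Rightarrow> 'x \<Rightarrow> 'x mv_term set" where
  "mv_free_gen X x = mv_class X {} (Var x)"

text \<open>The relations expressing that \<open>a \<mapsto> Var (j a)\<close> is a homomorphism on \<open>A\<close>.\<close>

definition mv_diagram :: "('a \<Rightarrow> 'x) \<Rightarrow> 'a mv \<Rightarrow> ('x mv_term \<times> 'x mv_term) set" where
  "mv_diagram j A =
     {(Var (j (mv_zero A)), Zero)} \<union>
     {(Var (j (mv_neg A a)), Neg (Var (j a))) | a. a \<in> mv_carrier A} \<union>
     {(Var (j (mv_plus A a b)), Plus (Var (j a)) (Var (j b))) | a b.
        a \<in> mv_carrier A \<and> b \<in> mv_carrier A}"

definition mv_coprod_vars :: "'a mv \<Rightarrow> 'b mv \<Rightarrow> ('a + 'b) set" where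
  "mv_coprod_vars A B = mv_carrier A <+> mv_carrier B"

definition mv_coprod_rels ::
  "'a mv \<Rightarrow> 'b mv \<Rightarrow> (('a + 'b) mv_term \<times> ('a + 'b) mv_term) set" where
  "mv_coprod_rels A B = mv_diagram Inl A \<union> mv_diagram Inr B"

definition mv_coprod :: "'a mv \<Rightarrow> 'b mv \<Rightarrow> ('a + 'b) mv_term set mv" where
  "mv_coprod A B = mv_presented (mv_coprod_vars A B) (mv_coprod_rels A B)"

definition mv_inl :: "'a mv \<Rightarrow> 'b mv \<Rightarrow> 'a \<Rightarrow> ('a + 'b) mv_term set" where
  "mv_inl A B a = mv_class (mv_coprod_vars A B) (mv_coprod_rels A B) (Var (Inl a))"

definition mv_inr :: "'a mv \<Rightarrow> 'b mv \<Rightarrow> 'b \<Rightarrow> ('a + 'b) mv_term set" where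
  "mv_inr A B b = mv_class (mv_coprod_vars A B) (mv_coprod_rels A B) (Var (Inr b))"

text \<open>The universal properties hold for test algebras over an arbitrary type.\<close>

lemma mv_algebra_free: "mv_algebra (mv_free X)"
  unfolding mv_free_def by (rule mv_algebra_presented)

lemma mv_free_gen_closed: "x \<in> X \<Longrightarrow> mv_free_gen X x \<in> mv_carrier (mv_free X)"
  by (simp add: mv_free_def mv_free_gen_def mv_presented_simps)

lemma mv_free_universal:
  fixes B :: "'b mv"
  assumes "mv_algebra B" and "f ` X \<subseteq> mv_carrier B"
  shows "\<exists>h \<in> mv_hom (mv_free X) B. \<forall>x\<in>X. h (mv_free_gen X x) = f x"
  unfolding mv_free_def mv_free_gen_def
  by (rule mv_presented_universal[OF assms]) simp_all

lemma mv_free_unique: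
  assumes "g \<in> mv_hom (mv_free X) B" "h \<in> mv_hom (mv_free X) B"
    and "\<And>x. x \<in> X \<Longrightarrow> g (mv_free_gen X x) = h (mv_free_gen X x)"
    and "a \<in> mv_carrier (mv_free X)"
  shows "g a = h a"
  using assms unfolding mv_free_def mv_free_gen_def by (rule mv_presented_unique)

lemma mv_algebra_coprod: "mv_algebra (mv_coprod A B)"
  unfolding mv_coprod_def by (rule mv_algebra_presented)

lemma mv_diagram_hom:
  assumes A: "mv_algebra A" and X: "j ` mv_carrier A \<subseteq> X" and R: "mv_diagram j A \<subseteq> R"
  shows "(\<lambda>a. mv_class X R (Var (j a))) \<in> mv_hom A (mv_presented X R)"
proof -
  interpret A: mv_algebra A by (rule A)
  have j: "a \<in> mv_carrier A \<Longrightarrow> Var (j a) \<in> mv_terms X" for a using X by auto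
  have "mv_eq X R (Var (j (mv_zero A))) Zero"
    using R A.zero_closed j by (intro mv_eq.rel) (auto simp: mv_diagram_def)
  moreover have "mv_eq X R (Var (j (mv_neg A a))) (Neg (Var (j a)))" if "a \<in> mv_carrier A" for a
    using R j[OF that] j[OF A.neg_closed[OF that]] that
    by (intro mv_eq.rel) (auto simp: mv_diagram_def)
  moreover have "mv_eq X R (Var (j (mv_plus A a b))) (Plus (Var (j a)) (Var (j b)))"
    if "a \<in> mv_carrier A" "b \<in> mv_carrier A" for a b
    using R j[OF that(1)] j[OF that(2)] j[OF A.plus_closed[OF that]] that
    by (intro mv_eq.rel) (auto simp: mv_diagram_def)
  ultimately show ?thesis
    using j by (auto simp: mv_hom_def mv_presented_simps mv_class_eq)
qed

lemma mv_inl_hom: "mv_algebra A \<Longrightarrow> mv_inl A B \<in> mv_hom A (mv_coprod A B)"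
  unfolding mv_inl_def [abs_def] mv_coprod_def
  by (rule mv_diagram_hom) (auto simp: mv_coprod_vars_def mv_coprod_rels_def)

lemma mv_inr_hom: "mv_algebra B \<Longrightarrow> mv_inr A B \<in> mv_hom B (mv_coprod A B)"
  unfolding mv_inr_def [abs_def] mv_coprod_def
  by (rule mv_diagram_hom) (auto simp: mv_coprod_vars_def mv_coprod_rels_def)

lemma mv_coprod_universal:
  fixes D :: "'d mv"
  assumes "mv_algebra D" and f: "f \<in> mv_hom A D" and g: "g \<in> mv_hom B D"
  shows "\<exists>h \<in> mv_hom (mv_coprod A B) D.
    (\<forall>a\<in>mv_carrier A. h (mv_inl A B a) = f a) \<and> (\<forall>b\<in>mv_carrier B. h (mv_inr A B b) = g b)"
proof -
  have "\<exists>h \<in> mv_hom (mv_coprod A B) D. \<forall>x\<in>mv_coprod_vars A B.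
    h (mv_class (mv_coprod_vars A B) (mv_coprod_rels A B) (Var x)) = case_sum f g x"
    unfolding mv_coprod_def
  proof (rule mv_presented_universal[OF assms(1)])
    show "case_sum f g ` mv_coprod_vars A B \<subseteq> mv_carrier D"
      using f g by (auto simp: mv_coprod_vars_def mv_hom_def)
    show "mv_eval D (case_sum f g) s = mv_eval D (case_sum f g) t"
      if "(s, t) \<in> mv_coprod_rels A B" for s t
      using that f g by (auto simp: mv_coprod_rels_def mv_diagram_def mv_hom_def)
  qed
  then obtain h where h: "h \<in> mv_hom (mv_coprod A B) D"
    and ext: "\<And>x. x \<in> mv_coprod_vars A B \<Longrightarrow>
      h (mv_class (mv_coprod_vars A B) (mv_coprod_rels A B) (Var x)) = case_sum f g x"
    by blast
  have "h (mv_inl A B a) = f a" if "a \<in> mv_carrier A" for a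
    using that ext[of "Inl a"] by (simp add: mv_coprod_vars_def mv_inl_def InlI)
  moreover have "h (mv_inr A B b) = g b" if "b \<in> mv_carrier B" for b
    using that ext[of "Inr b"] by (simp add: mv_coprod_vars_def mv_inr_def InrI)
  ultimately show ?thesis using h by blast
qed

lemma mv_coprod_unique:
  assumes "h \<in> mv_hom (mv_coprod A B) D" "k \<in> mv_hom (mv_coprod A B) D"
    and "\<And>a. a \<in> mv_carrier A \<Longrightarrow> h (mv_inl A B a) = k (mv_inl A B a)"
    and "\<And>b. b \<in> mv_carrier B \<Longrightarrow> h (mv_inr A B b) = k (mv_inr A B b)"
    and "c \<in> mv_carrier (mv_coprod A B)"
  shows "h c = k c"
proof (rule mv_presented_unique)
  show "h \<in> mv_hom (mv_presented (mv_coprod_vars A B) (mv_coprod_rels A B)) D"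
    "k \<in> mv_hom (mv_presented (mv_coprod_vars A B) (mv_coprod_rels A B)) D"
    "c \<in> mv_carrier (mv_presented (mv_coprod_vars A B) (mv_coprod_rels A B))"
    using assms(1,2,5) by (simp_all only: mv_coprod_def)
  fix x assume "x \<in> mv_coprod_vars A B"
  then consider a where "x = Inl a" "a \<in> mv_carrier A" | b where "x = Inr b" "b \<in> mv_carrier B"
    unfolding mv_coprod_vars_def by blast
  then show "h (mv_class (mv_coprod_vars A B) (mv_coprod_rels A B) (Var x)) =
      k (mv_class (mv_coprod_vars A B) (mv_coprod_rels A B) (Var x))"
    by cases (use assms(3,4) in \<open>simp_all only: mv_inl_def mv_inr_def\<close>)
qed

end

theory Submission
  imports Defs "HOL-Analysis.Sigma_Algebra"
begin

text \<open>
  In each case there is a surjective endomorphism that is not injective.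

  (i) A non-injective surjection of the set of free generators onto itself extends.

  (ii) Homomorphisms out of the Chang algebra are choices of an infinitesimal element, and the
  infinitesimals of an MV-algebra are closed under addition. Hence the coproduct, generated by two
  infinitesimals \<open>x\<close> and \<open>y\<close>, has an endomorphism with \<open>x \<mapsto> x\<close> and \<open>y \<mapsto> x \<oplus> y\<close>. It is onto
  because \<open>y\<close> is the truncated difference of \<open>x \<oplus> y\<close> and \<open>x\<close>; it kills the truncated difference
  of \<open>x\<close> and \<open>y\<close>, which is nonzero since there is a homomorphism with \<open>x \<mapsto> \<epsilon>\<close>, \<open>y \<mapsto> 0\<close>.

  (iii) Represent the algebra on its Stone space. If there are infinitely many isolated points,
  some sequence of them converges, and shifting it is a continuous injection that is not onto.
  Otherwise the space is a finite set plus a Cantor space, and the Cantor space embeds properly into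
  itself by prefixing every binary sequence with a fixed digit.
\<close>

section \<open>Homomorphisms\<close>

lemma mv_homD:
  assumes "h \<in> mv_hom A B"
  shows "x \<in> mv_carrier A \<Longrightarrow> h x \<in> mv_carrier B"
    and "h (mv_zero A) = mv_zero B"
    and "x \<in> mv_carrier A \<Longrightarrow> h (mv_neg A x) = mv_neg B (h x)"
    and "x \<in> mv_carrier A \<Longrightarrow> y \<in> mv_carrier A \<Longrightarrow> h (mv_plus A x y) = mv_plus B (h x) (h y)"
  using assms by (auto simp: mv_hom_def)

lemma mv_hom_id: "(\<lambda>x. x) \<in> mv_hom A A"
  by (auto simp: mv_hom_def)

lemma mv_hom_comp:
  assumes "g \<in> mv_hom B C" "f \<in> mv_hom A B"
  shows "(\<lambda>x. g (f x)) \<in> mv_hom A C"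
  unfolding mv_hom_def[of A C]
  by (simp add: image_subset_iff mv_homD[OF assms(1)] mv_homD[OF assms(2)])

lemma mv_iso_inv:
  assumes A: "mv_algebra A" and f: "f \<in> mv_iso A B"
  shows "inv_into (mv_carrier A) f \<in> mv_hom B A"
proof -
  interpret A: mv_algebra A by (rule A)
  let ?g = "inv_into (mv_carrier A) f"
  have hom: "f \<in> mv_hom A B" and bij: "bij_betw f (mv_carrier A) (mv_carrier B)"
    using f by (auto simp: mv_iso_def)
  have g: "?g y \<in> mv_carrier A" "f (?g y) = y" if "y \<in> mv_carrier B" for y
    using that bij by (auto simp: bij_betw_def inv_into_into f_inv_into_f)
  have gf: "?g (f x) = x" if "x \<in> mv_carrier A" for x
    using that bij by (simp add: bij_betw_def)
  have "?g (mv_zero B) = mv_zero A"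
    using gf[OF A.zero_closed] by (simp add: mv_homD(2)[OF hom])
  moreover have "?g (mv_neg B y) = mv_neg A (?g y)" if "y \<in> mv_carrier B" for y
    using gf[OF A.neg_closed[OF g(1)[OF that]]] g[OF that] by (simp add: mv_homD(3)[OF hom])
  moreover have "?g (mv_plus B y z) = mv_plus A (?g y) (?g z)"
    if "y \<in> mv_carrier B" "z \<in> mv_carrier B" for y z
    using gf[OF A.plus_closed[OF g(1)[OF that(1)] g(1)[OF that(2)]]] g[OF that(1)] g[OF that(2)]
    by (simp add: mv_homD(4)[OF hom])
  ultimately show ?thesis using g(1) by (simp add: mv_hom_def image_subset_iff)
qed

text \<open>Conjugating \<open>h\<close> by an isomorphism gives a surjective endomorphism of
  \<open>A\<close> that still identifies two elements. Each of the three cases can thus work in a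
  convenient concrete copy \<open>B\<close>.\<close>

lemma not_hopfian_isomorphicI:
  assumes A: "mv_algebra A" and iso: "mv_isomorphic A B"
    and h: "h \<in> mv_hom B B" and onto: "mv_carrier B \<subseteq> h ` mv_carrier B"
    and not_inj: "x \<in> mv_carrier B" "y \<in> mv_carrier B" "x \<noteq> y" "h x = h y"
  shows "\<not> hopfian A"
proof
  assume hopf: "hopfian A"
  obtain f where f: "f \<in> mv_iso A B" using iso by (auto simp: mv_isomorphic_def)
  let ?g = "inv_into (mv_carrier A) f"
  have hom: "f \<in> mv_hom A B" and bij: "bij_betw f (mv_carrier A) (mv_carrier B)"
    using f by (auto simp: mv_iso_def)
  have img: "f ` mv_carrier A = mv_carrier B" "?g ` mv_carrier B = mv_carrier A"
    using bij bij_betw_inv_into[OF bij] by (auto simp: bij_betw_def)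
  have himg: "h ` mv_carrier B = mv_carrier B" using onto mv_homD(1)[OF h] by blast
  have k: "(\<lambda>x. ?g (h (f x))) \<in> mv_hom A A"
    using mv_hom_comp[OF mv_iso_inv[OF A f] mv_hom_comp[OF h hom]] .
  have "(\<lambda>x. ?g (h (f x))) ` mv_carrier A = ?g ` (h ` (f ` mv_carrier A))" by blast
  also have "\<dots> = mv_carrier A" by (simp add: img himg)
  finally have "(\<lambda>x. ?g (h (f x))) \<in> mv_iso A A"
    using hopf k by (auto simp: hopfian_def)
  then have inj: "inj_on (\<lambda>x. ?g (h (f x))) (mv_carrier A)"
    by (simp add: mv_iso_def bij_betw_def)
  have "?g x = ?g y"
  proof (rule inj_onD[OF inj])
    show "?g (h (f (?g x))) = ?g (h (f (?g y)))"
      using not_inj img(1) by (simp add: f_inv_into_f)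
  qed (use not_inj img(2) in blast)+
  then show False
    using not_inj img(1) by (metis f_inv_into_f)
qed


section \<open>MV-algebra arithmetic\<close>

text \<open>The natural order in equational form, so that homomorphisms preserve it at once.\<close>

definition mv_le :: "'a mv \<Rightarrow> 'a \<Rightarrow> 'a \<Rightarrow> bool" where
  "mv_le A x y \<longleftrightarrow> mv_plus A (mv_neg A x) y = mv_neg A (mv_zero A)"

definition mv_mult :: "'a mv \<Rightarrow> nat \<Rightarrow> 'a \<Rightarrow> 'a" where
  "mv_mult A n z = (mv_plus A z ^^ n) (mv_zero A)"

text \<open>Zero counts as infinitesimal. Each multiple is compared with its own negation, the form
  of hypothesis that \<open>le_neg_of_self\<close> takes.\<close>

definition mv_infinitesimal :: "'a mv \<Rightarrow> 'a \<Rightarrow> bool" where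
  "mv_infinitesimal A z \<longleftrightarrow>
     z \<in> mv_carrier A \<and> (\<forall>n. mv_le A (mv_mult A n z) (mv_neg A (mv_mult A n z)))"

lemma mv_mult_simps [simp]:
  "mv_mult A 0 z = mv_zero A"
  "mv_mult A (Suc n) z = mv_plus A z (mv_mult A n z)"
  by (simp_all add: mv_mult_def)

context mv_algebra
begin

abbreviation plus_syntax (infixl "\<oplus>" 65) where "x \<oplus> y \<equiv> mv_plus A x y"
abbreviation neg_syntax ("\<sim> _" [80] 80) where "\<sim> x \<equiv> mv_neg A x"
abbreviation le_syntax (infix "\<preceq>" 50) where "x \<preceq> y \<equiv> mv_le A x y"
abbreviation zero_syntax ("\<zero>") where "\<zero> \<equiv> mv_zero A"
abbreviation one_syntax ("\<one>") where "\<one> \<equiv> mv_neg A (mv_zero A)"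
abbreviation times_syntax (infixl "\<odot>" 70) where "x \<odot> y \<equiv> \<sim> (\<sim> x \<oplus> \<sim> y)"

lemmas closed = zero_closed neg_closed plus_closed

lemma plus_left_comm:
  "\<lbrakk>x \<in> mv_carrier A; y \<in> mv_carrier A; z \<in> mv_carrier A\<rbrakk> \<Longrightarrow> x \<oplus> (y \<oplus> z) = y \<oplus> (x \<oplus> z)"
  by (metis plus_assoc plus_comm)

lemmas plus_ac = plus_assoc plus_comm plus_left_comm

lemma zero_plus: "x \<in> mv_carrier A \<Longrightarrow> \<zero> \<oplus> x = x"
  by (simp add: plus_comm[of \<zero>] closed plus_zero)

lemma one_plus: "x \<in> mv_carrier A \<Longrightarrow> \<one> \<oplus> x = \<one>"
  by (simp add: plus_comm[of \<one>] closed plus_top)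

lemmas basic = closed neg_neg plus_zero plus_top zero_plus one_plus

lemma plus_neg: "x \<in> mv_carrier A \<Longrightarrow> x \<oplus> \<sim> x = \<one>"
  using lukasiewicz[of x \<one>] by (simp add: basic plus_comm)

lemma neg_plus: "x \<in> mv_carrier A \<Longrightarrow> \<sim> x \<oplus> x = \<one>"
  using plus_neg[of x] by (simp add: plus_comm closed)

section \<open>The natural order\<close>

lemma le_plus: "x \<in> mv_carrier A \<Longrightarrow> y \<in> mv_carrier A \<Longrightarrow> x \<preceq> x \<oplus> y"
  unfolding mv_le_def by (metis neg_plus plus_assoc one_plus closed)

text \<open>Both sides of the Lukasiewicz equation express the join of \<open>x\<close> and
  \<open>y\<close>; for \<open>x \<preceq> y\<close> one of them collapses to
  \<open>y\<close>.\<close>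

lemma le_sup: "x \<in> mv_carrier A \<Longrightarrow> y \<in> mv_carrier A \<Longrightarrow> x \<preceq> y \<Longrightarrow> y = \<sim> (\<sim> y \<oplus> x) \<oplus> x"
  using lukasiewicz[of x y] by (simp add: mv_le_def basic)

text \<open>The witness is the truncated difference supplied by \<open>le_sup\<close>. This additive
  form yields transitivity and monotonicity.\<close>

lemma le_iff: "x \<in> mv_carrier A \<Longrightarrow> y \<in> mv_carrier A \<Longrightarrow> x \<preceq> y \<longleftrightarrow> (\<exists>w\<in>mv_carrier A. y = x \<oplus> w)"
  by (metis le_plus le_sup plus_comm closed)

lemma le_refl: "x \<in> mv_carrier A \<Longrightarrow> x \<preceq> x"
  by (simp add: mv_le_def neg_plus)

lemma le_trans:
  assumes "x \<in> mv_carrier A" "y \<in> mv_carrier A" "z \<in> mv_carrier A" "x \<preceq> y" "y \<preceq> z"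
  shows "x \<preceq> z"
  using assms by (metis le_iff plus_assoc plus_closed)

lemma plus_mono:
  assumes "x \<in> mv_carrier A" "y \<in> mv_carrier A" "z \<in> mv_carrier A" "x \<preceq> y"
  shows "x \<oplus> z \<preceq> y \<oplus> z"
proof -
  obtain w where "w \<in> mv_carrier A" "y = x \<oplus> w" using assms le_iff by blast
  then have "y \<oplus> z = (x \<oplus> z) \<oplus> w" using assms by (simp add: plus_ac closed)
  then show ?thesis using le_plus \<open>w \<in> _\<close> assms by (simp add: closed)
qed

lemma neg_le_iff: "x \<in> mv_carrier A \<Longrightarrow> y \<in> mv_carrier A \<Longrightarrow> \<sim> y \<preceq> \<sim> x \<longleftrightarrow> x \<preceq> y"
  by (simp add: mv_le_def basic plus_comm)

lemma le_neg_comm: "x \<in> mv_carrier A \<Longrightarrow> y \<in> mv_carrier A \<Longrightarrow> x \<preceq> \<sim> y \<longleftrightarrow> y \<preceq> \<sim> x"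
  by (simp add: mv_le_def basic plus_comm)

lemma one_le: "x \<in> mv_carrier A \<Longrightarrow> \<one> \<preceq> x \<Longrightarrow> x = \<one>"
  by (simp add: mv_le_def basic)

lemma le_antisym:
  assumes "x \<in> mv_carrier A" "y \<in> mv_carrier A" "x \<preceq> y" "y \<preceq> x"
  shows "x = y"
  using lukasiewicz[of x y] assms by (simp add: mv_le_def basic)

text \<open>The term on the left is the join of \<open>p\<close> and \<open>q\<close>. It is
  monotone in \<open>p\<close>, and with \<open>r\<close> in place of \<open>p\<close> it equals
  \<open>r\<close> by \<open>le_sup\<close>.\<close>

lemma sup_least:
  assumes "p \<in> mv_carrier A" "q \<in> mv_carrier A" "r \<in> mv_carrier A" "p \<preceq> r" "q \<preceq> r"
  shows "\<sim> (\<sim> p \<oplus> q) \<oplus> q \<preceq> r"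
proof -
  have "\<sim> (\<sim> p \<oplus> q) \<oplus> q \<preceq> \<sim> (\<sim> r \<oplus> q) \<oplus> q"
    using assms by (intro plus_mono) (auto simp: closed neg_le_iff intro!: plus_mono)
  then show ?thesis using le_sup[of q r] assms by simp
qed

section \<open>Meets and prelinearity\<close>

lemma times_inf_comm:
  assumes "x \<in> mv_carrier A" "w \<in> mv_carrier A"
  shows "x \<odot> (\<sim> x \<oplus> w) = w \<odot> (\<sim> w \<oplus> x)"
  using lukasiewicz[of "\<sim> x" "\<sim> w"] assms by (simp add: basic plus_comm)

text \<open>A term \<open>s \<odot> (\<sim> s \<oplus> t)\<close> is the meet of \<open>s\<close>
  and \<open>t\<close>. Exchanging the arguments of such meets three times exposes the factor
  \<open>y \<odot> \<sim> w\<close>, which vanishes because \<open>y \<preceq> w\<close>.\<close>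

lemma prelinear:
  assumes x: "x \<in> mv_carrier A" and y: "y \<in> mv_carrier A"
  shows "(x \<odot> \<sim> y) \<odot> (\<sim> (x \<odot> \<sim> y) \<oplus> (y \<odot> \<sim> x)) = \<zero>"
proof -
  define v where "v = y \<odot> \<sim> x"
  \<comment> \<open>Chosen so that \<open>\<sim> (x \<odot> \<sim> y) \<oplus> v\<close> regroups as
    \<open>\<sim> x \<oplus> w\<close>, which produces a meet of \<open>x\<close> and
    \<open>w\<close>.\<close>
  define w where "w = y \<oplus> v"
  have v: "v \<in> mv_carrier A" and w: "w \<in> mv_carrier A"
    using x y by (simp_all add: v_def w_def closed)
  note c = x y v w
  have "(x \<odot> \<sim> y) \<odot> (\<sim> (x \<odot> \<sim> y) \<oplus> v) = \<sim> y \<odot> (x \<odot> (\<sim> x \<oplus> w))"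
    using c by (simp add: w_def basic plus_ac)
  also have "\<dots> = \<sim> y \<odot> (w \<odot> (\<sim> w \<oplus> x))"
    using times_inf_comm[OF x w] by simp
  also have "\<dots> = (\<sim> y \<odot> (\<sim> \<sim> y \<oplus> v)) \<odot> (\<sim> w \<oplus> x)"
    using c by (simp add: w_def basic plus_ac)
  also have "\<dots> = (v \<odot> (\<sim> v \<oplus> \<sim> y)) \<odot> (\<sim> w \<oplus> x)"
    using times_inf_comm[of "\<sim> y" v] c by (simp add: closed)
  also have "\<dots> = (y \<odot> (\<sim> v \<oplus> \<sim> y)) \<odot> (\<sim> x \<odot> (\<sim> \<sim> x \<oplus> \<sim> w))"
    using c by (simp add: v_def basic plus_ac)
  also have "\<dots> = (y \<odot> (\<sim> v \<oplus> \<sim> y)) \<odot> (\<sim> w \<odot> (\<sim> \<sim> w \<oplus> \<sim> x))"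
    using times_inf_comm[of "\<sim> x" "\<sim> w"] c by (simp add: closed)
  also have "\<dots> = (y \<odot> \<sim> w) \<odot> ((\<sim> v \<oplus> \<sim> y) \<odot> (\<sim> \<sim> w \<oplus> \<sim> x))"
    using c by (simp add: basic plus_ac)
  also have "y \<odot> \<sim> w = \<zero>"
  proof -
    have "\<sim> y \<oplus> \<sim> \<sim> w = (\<sim> y \<oplus> y) \<oplus> v" using c by (simp add: w_def basic plus_assoc)
    then show ?thesis using c by (simp add: basic neg_plus)
  qed
  also have "\<zero> \<odot> ((\<sim> v \<oplus> \<sim> y) \<odot> (\<sim> \<sim> w \<oplus> \<sim> x)) = \<zero>"
    using c by (simp add: basic)
  finally show ?thesis by (simp add: v_def)
qed

text \<open>Here \<open>a \<preceq> \<sim> b\<close> means \<open>a \<odot> b = \<zero>\<close>. By prelinearity the claim reduces to the two cases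
  \<open>a \<preceq> b\<close> and \<open>b \<preceq> a\<close>, where \<open>a \<odot> b\<close> is below \<open>b \<odot> b\<close> or \<open>a \<odot> a\<close>.\<close>

lemma le_neg_of_self:
  assumes a: "a \<in> mv_carrier A" and b: "b \<in> mv_carrier A"
    and aa: "a \<preceq> \<sim> a" and bb: "b \<preceq> \<sim> b"
  shows "a \<preceq> \<sim> b"
proof -
  have le: "\<sim> c \<oplus> d \<preceq> \<sim> c \<oplus> \<sim> d"
    if c: "c \<in> mv_carrier A" and d: "d \<in> mv_carrier A" and dd: "d \<preceq> \<sim> d" for c d
  proof -
    have "\<sim> (\<sim> c \<oplus> d) \<oplus> (\<sim> c \<oplus> \<sim> d) = (\<sim> (\<sim> \<sim> d \<oplus> \<sim> c) \<oplus> \<sim> c) \<oplus> \<sim> d"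
      using c d by (simp add: basic plus_ac)
    also have "\<dots> = (\<sim> (\<sim> \<sim> c \<oplus> \<sim> d) \<oplus> \<sim> d) \<oplus> \<sim> d"
      using lukasiewicz[of "\<sim> d" "\<sim> c"] c d by (simp add: closed)
    also have "\<dots> = \<sim> (\<sim> \<sim> c \<oplus> \<sim> d) \<oplus> (\<sim> d \<oplus> \<sim> d)"
      using c d by (simp add: closed plus_assoc)
    also have "\<dots> = \<one>" using dd c d by (simp add: mv_le_def basic)
    finally show ?thesis by (simp add: mv_le_def)
  qed
  \<comment> \<open>The two implications between \<open>a\<close> and \<open>b\<close>. Both lie
    below \<open>\<sim> a \<oplus> \<sim> b\<close> by \<open>le\<close>, and prelinearity makes
    their join the top element.\<close>
  let ?p = "\<sim> a \<oplus> b" and ?q = "\<sim> b \<oplus> a"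
  have "\<sim> (\<sim> ?p \<oplus> ?q) \<oplus> ?q \<preceq> \<sim> a \<oplus> \<sim> b"
    using le[OF a b bb] le[OF b a aa] a b by (intro sup_least) (simp_all add: closed plus_comm)
  moreover have "\<sim> (\<sim> ?p \<oplus> ?q) \<oplus> ?q = \<one>"
  proof -
    have "\<sim> (\<sim> (\<sim> ?q \<oplus> ?p) \<oplus> ?p) = \<zero>"
      using prelinear[OF a b] a b by (simp add: basic plus_comm)
    then have "\<sim> (\<sim> (\<sim> ?p \<oplus> ?q) \<oplus> ?q) = \<zero>"
      using lukasiewicz[of ?p ?q] a b by (simp add: closed)
    then have "\<sim> \<sim> (\<sim> (\<sim> ?p \<oplus> ?q) \<oplus> ?q) = \<one>" by simp
    then show ?thesis using a b by (simp add: basic)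
  qed
  ultimately show ?thesis using one_le[of "\<sim> a \<oplus> \<sim> b"] a b by (simp add: closed mv_le_def)
qed

text \<open>The left side is the join of \<open>\<sim> a\<close> and \<open>b\<close>. Read under
  negation: subtracting \<open>b\<close> from the untruncated sum \<open>a \<oplus> b\<close>
  returns \<open>a\<close>.\<close>

lemma neg_plus_cancel:
  assumes "a \<in> mv_carrier A" "b \<in> mv_carrier A" "a \<preceq> \<sim> b"
  shows "\<sim> (a \<oplus> b) \<oplus> b = \<sim> a"
  using lukasiewicz[of "\<sim> a" b] assms by (simp add: basic mv_le_def plus_comm)

text \<open>Associativity of the partial addition that is defined on pairs with \<open>a \<odot> b = \<zero>\<close>.\<close>

lemma le_neg_assoc:
  assumes c: "a \<in> mv_carrier A" "b \<in> mv_carrier A" "c \<in> mv_carrier A"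
    and "a \<preceq> \<sim> b" "a \<oplus> b \<preceq> \<sim> c"
  shows "a \<preceq> \<sim> (b \<oplus> c)"
proof -
  have "c \<preceq> \<sim> (a \<oplus> b)" using assms le_neg_comm by (simp add: closed)
  then have "c \<oplus> b \<preceq> \<sim> (a \<oplus> b) \<oplus> b" using c by (intro plus_mono) (simp_all add: closed)
  then show ?thesis
    using assms neg_plus_cancel le_neg_comm[of a "b \<oplus> c"] by (simp add: closed plus_comm)
qed

section \<open>Multiples and infinitesimals\<close>

lemma mult_closed: "z \<in> mv_carrier A \<Longrightarrow> mv_mult A n z \<in> mv_carrier A"
  by (induction n) (simp_all add: closed)

lemma mult_add:
  "z \<in> mv_carrier A \<Longrightarrow> mv_mult A (m + n) z = mv_mult A m z \<oplus> mv_mult A n z"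
  by (induction m) (simp_all add: basic mult_closed plus_assoc)

lemma mult_plus:
  "x \<in> mv_carrier A \<Longrightarrow> y \<in> mv_carrier A \<Longrightarrow>
   mv_mult A n (x \<oplus> y) = mv_mult A n x \<oplus> mv_mult A n y"
  by (induction n) (simp_all add: basic mult_closed plus_ac)

lemma mult_zero: "mv_mult A n \<zero> = \<zero>"
  by (induction n) (simp_all add: basic)

lemma mult_mono:
  assumes "x \<in> mv_carrier A" "y \<in> mv_carrier A" "x \<preceq> y"
  shows "mv_mult A n x \<preceq> mv_mult A n y"
proof -
  obtain w where "w \<in> mv_carrier A" "y = x \<oplus> w" using assms le_iff by blast
  then show ?thesis using assms by (simp add: mult_plus le_plus mult_closed)
qed

lemma infinitesimal_mult:
  assumes "mv_infinitesimal A z"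
  shows "mv_mult A m z \<preceq> \<sim> mv_mult A n z"
  by (rule le_neg_of_self) (use assms in \<open>simp_all add: mv_infinitesimal_def mult_closed\<close>)

text \<open>The two multiples may be incomparable, so this depends on prelinearity through
  \<open>le_neg_of_self\<close>. It says that their sum is not truncated.\<close>

lemma infinitesimal_mult2:
  assumes "mv_infinitesimal A x" "mv_infinitesimal A y"
  shows "mv_mult A m x \<preceq> \<sim> mv_mult A n y"
  by (rule le_neg_of_self) (use assms in \<open>simp_all add: mv_infinitesimal_def mult_closed\<close>)

lemma infinitesimal_zero: "mv_infinitesimal A \<zero>"
  by (simp add: mv_infinitesimal_def mult_zero basic mv_le_def)

lemma infinitesimal_plus:
  assumes x: "mv_infinitesimal A x" and y: "mv_infinitesimal A y"
  shows "mv_infinitesimal A (x \<oplus> y)"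
  unfolding mv_infinitesimal_def
proof (intro conjI allI)
  have c: "x \<in> mv_carrier A" "y \<in> mv_carrier A" using x y by (auto simp: mv_infinitesimal_def)
  then show "x \<oplus> y \<in> mv_carrier A" by (simp add: closed)
  fix n
  define a b where "a = mv_mult A n x" and "b = mv_mult A n y"
  have ab: "a \<in> mv_carrier A" "b \<in> mv_carrier A" using c by (simp_all add: a_def b_def mult_closed)
  have aa: "a \<preceq> \<sim> a" and bb: "b \<preceq> \<sim> b"
    using infinitesimal_mult x y by (auto simp: a_def b_def)
  \<comment> \<open>The doubles are again multiples of \<open>x\<close> and \<open>y\<close>, so
    \<open>a\<close>, \<open>a\<close>, \<open>b\<close>, \<open>b\<close> add up without
    truncation. What follows rebrackets this sum as
    \<open>(a \<oplus> b) \<oplus> (b \<oplus> a)\<close> inside the partial addition.\<close>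
  have "a \<oplus> a \<preceq> \<sim> (b \<oplus> b)"
    using infinitesimal_mult2[OF x y, of "n + n" "n + n"] c by (simp add: mult_add a_def b_def)
  then have a_abb: "a \<preceq> \<sim> (a \<oplus> (b \<oplus> b))"
    using le_neg_assoc[of a a "b \<oplus> b"] ab aa by (simp add: closed)
  have "a \<preceq> \<sim> (b \<oplus> b)"
    using infinitesimal_mult2[OF x y, of n "n + n"] c by (simp add: mult_add a_def b_def)
  then have "b \<oplus> b \<preceq> \<sim> a" using le_neg_comm ab by (simp add: closed)
  then have "b \<preceq> \<sim> (b \<oplus> a)" using le_neg_assoc[of b b a] ab bb by (simp add: closed)
  then have "a \<oplus> b \<preceq> \<sim> b" using le_neg_comm[of b "a \<oplus> b"] ab by (simp add: closed plus_comm)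
  moreover have "(a \<oplus> b) \<oplus> b \<preceq> \<sim> a"
    using a_abb le_neg_comm[of a "a \<oplus> (b \<oplus> b)"] ab by (simp add: closed plus_assoc)
  ultimately have "a \<oplus> b \<preceq> \<sim> (b \<oplus> a)" using le_neg_assoc[of "a \<oplus> b" b a] ab by (simp add: closed)
  then have "a \<oplus> b \<preceq> \<sim> (a \<oplus> b)" using ab by (simp add: plus_comm)
  then show "mv_mult A n (x \<oplus> y) \<preceq> \<sim> mv_mult A n (x \<oplus> y)"
    using c by (simp add: mult_plus a_def b_def)
qed

lemma infinitesimal_le:
  assumes x: "mv_infinitesimal A x" and y: "y \<in> mv_carrier A" "y \<preceq> x"
  shows "mv_infinitesimal A y"
  unfolding mv_infinitesimal_def
proof (intro conjI allI)
  fix n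
  have c: "x \<in> mv_carrier A" using x by (simp add: mv_infinitesimal_def)
  have le: "mv_mult A n y \<preceq> mv_mult A n x" using y c by (intro mult_mono)
  then have "\<sim> mv_mult A n x \<preceq> \<sim> mv_mult A n y" using y c by (simp add: neg_le_iff mult_closed)
  moreover have "mv_mult A n x \<preceq> \<sim> mv_mult A n x" using x by (simp add: mv_infinitesimal_def)
  ultimately show "mv_mult A n y \<preceq> \<sim> mv_mult A n y"
    using le c y by (meson le_trans mult_closed neg_closed)
qed (rule y)

end

lemma mv_hom_le:
  assumes "h \<in> mv_hom A B" "mv_algebra A" "x \<in> mv_carrier A" "y \<in> mv_carrier A" "mv_le A x y"
  shows "mv_le B (h x) (h y)"
proof -
  interpret A: mv_algebra A by fact
  have "h (mv_plus A (mv_neg A x) y) = h (mv_neg A (mv_zero A))"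
    using assms(5) by (simp add: mv_le_def)
  then show ?thesis using assms by (simp add: mv_le_def mv_homD[OF assms(1)] A.closed)
qed

lemma mv_hom_mult:
  assumes "h \<in> mv_hom A B" "mv_algebra A" "x \<in> mv_carrier A"
  shows "h (mv_mult A n x) = mv_mult B n (h x)"
proof -
  interpret A: mv_algebra A by fact
  show ?thesis
    by (induction n) (simp_all add: mv_homD[OF assms(1)] assms(3) A.mult_closed)
qed

lemma mv_hom_infinitesimal:
  assumes "h \<in> mv_hom A B" "mv_algebra A" "mv_infinitesimal A x"
  shows "mv_infinitesimal B (h x)"
proof -
  interpret A: mv_algebra A by fact
  have c: "x \<in> mv_carrier A" using assms(3) by (simp add: mv_infinitesimal_def)
  have "mv_le B (mv_mult B n (h x)) (mv_neg B (mv_mult B n (h x)))" for n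
    using mv_hom_le[OF assms(1,2), of "mv_mult A n x" "mv_neg A (mv_mult A n x)"] assms(3) c
    by (simp add: A.closed A.mult_closed mv_infinitesimal_def mv_homD(3)[OF assms(1)]
        mv_hom_mult[OF assms(1,2)])
  then show ?thesis using c by (simp add: mv_infinitesimal_def mv_homD(1)[OF assms(1)])
qed


section \<open>The Chang algebra\<close>

text \<open>The candidate homomorphism with \<open>Lex 0 1\<close> sent to \<open>z\<close>. On the
  carrier the second coordinate has the sign that makes \<open>nat\<close> lossless; values
  elsewhere are irrelevant.\<close>

definition chang_map :: "'a mv \<Rightarrow> 'a \<Rightarrow> (int, int) lex \<Rightarrow> 'a" where
  "chang_map A z c = (case c of Lex a b \<Rightarrow>
     if a = 0 then mv_mult A (nat b) z else mv_neg A (mv_mult A (nat (- b)) z))"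

lemma chang_map_simps [simp]:
  "chang_map A z (Lex 0 b) = mv_mult A (nat b) z"
  "chang_map A z (Lex 1 b) = mv_neg A (mv_mult A (nat (- b)) z)"
  by (simp_all add: chang_map_def)

lemma Chang_simps [simp]:
  "mv_zero Chang = Lex 0 0"
  "mv_neg Chang (Lex a b) = Lex (1 - a) (- b)"
  "mv_plus Chang (Lex a b) (Lex c d) = min (Lex 1 0) (Lex (a + c) (b + d))"
  by (simp_all add: Chang_def mv_Gamma_def zero_lex_def inf_lex_def)

lemma Lex_in_Chang: "Lex a b \<in> mv_carrier Chang \<longleftrightarrow> a = 0 \<and> 0 \<le> b \<or> a = 1 \<and> b \<le> 0"
  by (auto simp: Chang_def mv_Gamma_def zero_lex_def)

lemma Chang_cases:
  assumes "c \<in> mv_carrier Chang"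
  obtains n where "c = Lex 0 (int n)" | n where "c = Lex 1 (- int n)"
proof (cases c)
  case (Lex a b)
  then consider "a = 0" "0 \<le> b" | "a = 1" "b \<le> 0" using assms by (auto simp: Lex_in_Chang)
  then show thesis
  proof cases
    case 1
    then show thesis using that(1)[of "nat b"] Lex by simp
  next
    case 2
    then show thesis using that(2)[of "nat (- b)"] Lex by simp
  qed
qed

lemma Chang_mult: "mv_mult Chang n (Lex 0 1) = Lex 0 (int n)"
  by (induction n) (auto simp: min_def)

lemma Chang_infinitesimal: "mv_infinitesimal Chang (Lex 0 1)"
  by (auto simp: mv_infinitesimal_def Lex_in_Chang mv_le_def Chang_mult min_def)

lemma chang_map_Chang: "c \<in> mv_carrier Chang \<Longrightarrow> chang_map Chang (Lex 0 1) c = c"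
  by (erule Chang_cases) (simp_all add: Chang_mult)

lemma chang_map_hom_apply:
  assumes "h \<in> mv_hom A B" "mv_algebra A" "z \<in> mv_carrier A"
  shows "h (chang_map A z c) = chang_map B (h z) c"
proof -
  interpret A: mv_algebra A by fact
  show ?thesis
    by (cases c) (simp add: chang_map_def mv_hom_mult[OF assms] mv_homD(3)[OF assms(1)]
        A.mult_closed assms(3))
qed

text \<open>\<open>Lex 0 1\<close> generates the Chang algebra: \<open>chang_map\<close> expresses
  each \<open>c\<close> through it by operations that homomorphisms preserve.\<close>

lemma Chang_hom_eq:
  assumes "h \<in> mv_hom Chang B" "c \<in> mv_carrier Chang"
  shows "h c = chang_map B (h (Lex 0 1)) c"
  using chang_map_hom_apply[OF assms(1) mv_algebra_Chang, of "Lex 0 1" c] assms(2)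
  by (simp add: Lex_in_Chang chang_map_Chang)

lemma (in mv_algebra) chang_map_hom:
  assumes z: "mv_infinitesimal A z"
  shows "chang_map A z \<in> mv_hom Chang A"
proof -
  have c: "z \<in> mv_carrier A" using z by (simp add: mv_infinitesimal_def)
  have m: "mv_mult A n z \<in> mv_carrier A" for n using c by (rule mult_closed)
  \<comment> \<open>The sum of a lower and an upper element: it reaches the top if
    \<open>n \<le> m\<close>, and otherwise is found by cancellation.\<close>
  have mixed: "chang_map A z (mv_plus Chang (Lex 0 (int m)) (Lex 1 (- int n))) =
      mv_mult A m z \<oplus> \<sim> mv_mult A n z" for m n
  proof (cases "n \<le> m")
    case True
    then obtain k where "m = k + n" by (metis le_add_diff_inverse2)
    then show ?thesis using m c by (simp add: min_def mult_add basic plus_assoc plus_neg)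
  next
    case False
    \<comment> \<open>The \<open>Suc\<close> records that the difference is positive, so that
      \<open>min\<close> does not truncate the sum in Chang.\<close>
    then obtain k where k: "n = Suc k + m" by (metis add.commute less_imp_Suc_add not_le_imp_less add_Suc_right)
    have "\<sim> mv_mult A n z \<oplus> mv_mult A m z = \<sim> mv_mult A (Suc k) z"
      unfolding k mult_add[OF c] by (intro neg_plus_cancel m infinitesimal_mult[OF z])
    then have "mv_mult A m z \<oplus> \<sim> mv_mult A n z = \<sim> mv_mult A (Suc k) z"
      using m by (simp only: plus_comm closed)
    moreover have "nat (int n - int m) = Suc k" using k by simp
    ultimately show ?thesis using k by (simp add: min_def del: mv_mult_simps)
  qed
  show ?thesis
    unfolding mv_hom_def
  proof (intro CollectI conjI ballI subsetI)
    fix y assume "y \<in> chang_map A z ` mv_carrier Chang"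
    then show "y \<in> mv_carrier A" by (auto elim!: Chang_cases simp: neg_closed m)
  next
    show "chang_map A z (mv_zero Chang) = \<zero>" by simp
  next
    fix x assume "x \<in> mv_carrier Chang"
    then show "chang_map A z (mv_neg Chang x) = \<sim> chang_map A z x"
      using m by (auto elim!: Chang_cases simp: neg_neg)
  next
    fix x y assume "x \<in> mv_carrier Chang" "y \<in> mv_carrier Chang"
    then show "chang_map A z (mv_plus Chang x y) = chang_map A z x \<oplus> chang_map A z y"
    proof (elim Chang_cases, goal_cases)
      case (1 k l)
      then show ?case by (simp add: min_def nat_add_distrib mult_add[OF c])
    next
      case (2 k l)
      then show ?case using mixed by simp
    next
      case (3 k l)
      have "mv_plus Chang x y = mv_plus Chang y x"
        using 3 by (simp add: add.commute)
      then show ?case using 3 mixed m by (simp add: plus_comm closed)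
    next
      \<comment> \<open>Two upper elements add up to the top in Chang; in \<open>A\<close> this is
        exactly \<open>infinitesimal_mult\<close>.\<close>
      case (4 k l)
      then show ?case
        using infinitesimal_mult[OF z, of k l] by (simp add: mv_le_def min_def basic)
    qed
  qed
qed


section \<open>Free algebras and the coproduct of two Chang algebras\<close>

definition set_mv :: "'c set \<Rightarrow> 'c set set \<Rightarrow> 'c set mv" where
  "set_mv S F = \<lparr>mv_carrier = F, mv_zero = {}, mv_neg = (\<lambda>x. S - x), mv_plus = (\<union>)\<rparr>"

lemma set_mv_simps [simp]:
  "mv_carrier (set_mv S F) = F" "mv_zero (set_mv S F) = {}"
  "mv_neg (set_mv S F) x = S - x" "mv_plus (set_mv S F) x y = x \<union> y"
  by (simp_all add: set_mv_def)

lemma mv_algebra_set_mv: "algebra S F \<Longrightarrow> mv_algebra (set_mv S F)"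
  by unfold_locales (auto simp: algebra_iff_Un)

text \<open>A homomorphism to the two-element algebra, the power set of a point, sends
  \<open>a\<close> to the top and \<open>b\<close> to the bottom.\<close>

lemma mv_free_gen_inj:
  assumes "a \<in> X" "b \<in> X" "a \<noteq> b"
  shows "mv_free_gen X a \<noteq> mv_free_gen X b"
proof -
  let ?B = "set_mv (UNIV :: unit set) UNIV"
  have "mv_algebra ?B" by (intro mv_algebra_set_mv) (simp add: algebra_iff_Un)
  then obtain h where "h \<in> mv_hom (mv_free X) ?B"
    "\<forall>x\<in>X. h (mv_free_gen X x) = (if x = a then UNIV else {})"
    using mv_free_universal[of ?B "\<lambda>x. if x = a then UNIV else {}" X] by auto
  then show ?thesis using assms by (metis UNIV_not_empty)
qed

lemma not_hopfian_free:
  assumes X: "infinite X" and F: "mv_algebra F" "mv_isomorphic F (mv_free X)"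
  shows "\<not> hopfian F"
proof -
  obtain a where a: "a \<in> X" using X by (metis finite.emptyI ex_in_conv)
  obtain s where s: "bij_betw s X (X - {a})" using infinite_imp_bij_betw[OF X] by blast
  \<comment> \<open>A left inverse of \<open>s\<close> that also fixes \<open>a\<close>, so
    \<open>a\<close> and \<open>s a\<close> both go to \<open>a\<close>. The extension
    \<open>g\<close> of \<open>s\<close> is then a right inverse of the extension \<open>h\<close>
    of \<open>r\<close>.\<close>
  define r where "r x = (if x = a then a else inv_into X s x)" for x
  have sX: "s x \<in> X" "s x \<noteq> a" "r (s x) = x" if "x \<in> X" for x
    using s that by (auto simp: bij_betw_def r_def)
  have rX: "r x \<in> X" if "x \<in> X" for x
    using that a s by (auto simp: r_def bij_betw_def intro!: inv_into_into)
  let ?P = "mv_free X"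
  obtain h where h: "h \<in> mv_hom ?P ?P" "\<And>x. x \<in> X \<Longrightarrow> h (mv_free_gen X x) = mv_free_gen X (r x)"
    using mv_free_universal[OF mv_algebra_free, of "\<lambda>x. mv_free_gen X (r x)" X X] rX
    by (auto simp: mv_free_gen_closed image_subset_iff)
  obtain g where g: "g \<in> mv_hom ?P ?P" "\<And>x. x \<in> X \<Longrightarrow> g (mv_free_gen X x) = mv_free_gen X (s x)"
    using mv_free_universal[OF mv_algebra_free, of "\<lambda>x. mv_free_gen X (s x)" X X] sX
    by (auto simp: mv_free_gen_closed image_subset_iff)
  have "h (g p) = p" if "p \<in> mv_carrier ?P" for p
    by (rule mv_free_unique[OF mv_hom_comp[OF h(1) g(1)] mv_hom_id _ that]) (simp add: g h sX)
  then have onto: "mv_carrier ?P \<subseteq> h ` mv_carrier ?P"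
    using mv_homD(1)[OF g(1)] by (metis image_eqI subsetI)
  show ?thesis
  proof (rule not_hopfian_isomorphicI[OF F h(1) onto])
    show "mv_free_gen X a \<noteq> mv_free_gen X (s a)"
      using mv_free_gen_inj[of a X "s a"] a sX[OF a] by simp
    show "h (mv_free_gen X a) = h (mv_free_gen X (s a))"
      using a sX[OF a] by (simp add: h r_def)
  qed (use a sX[OF a] in \<open>simp_all add: mv_free_gen_closed\<close>)
qed

section \<open>The coproduct of two Chang algebras\<close>

lemma not_hopfian_Chang_coprod:
  fixes P :: "'p mv"
  assumes P: "mv_algebra P" "mv_isomorphic P (mv_coprod Chang Chang)"
  shows "\<not> hopfian P"
proof -
  let ?Q = "mv_coprod Chang Chang" and ?e = "Lex 0 1 :: (int, int) lex"
  interpret Q: mv_algebra ?Q by (rule mv_algebra_coprod)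
  interpret C: mv_algebra Chang by (rule mv_algebra_Chang)
  define x y where "x = mv_inl Chang Chang ?e" and "y = mv_inr Chang Chang ?e"
  note inl = mv_inl_hom[OF mv_algebra_Chang, of Chang]
    and inr = mv_inr_hom[OF mv_algebra_Chang, of Chang]
  have x: "mv_infinitesimal ?Q x" and y: "mv_infinitesimal ?Q y"
    unfolding x_def y_def using mv_hom_infinitesimal[OF _ mv_algebra_Chang Chang_infinitesimal]
      inl inr by blast+
  have xy: "x \<in> mv_carrier ?Q" "y \<in> mv_carrier ?Q"
    using x y by (auto simp: mv_infinitesimal_def)
  define z where "z = mv_plus ?Q x y"
  \<comment> \<open>The truncated difference of \<open>y\<close> and \<open>x\<close>. The
    endomorphism \<open>h\<close> will send it to \<open>y\<close>, so \<open>y \<mapsto> w\<close>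
    defines a right inverse \<open>g\<close>; this is a legitimate choice because
    \<open>w \<preceq> y\<close> makes \<open>w\<close> infinitesimal.\<close>
  define w where "w = mv_neg ?Q (mv_plus ?Q (mv_neg ?Q y) x)"
  have e: "?e \<in> mv_carrier Chang" by (simp add: Lex_in_Chang)
  have z: "mv_infinitesimal ?Q z" unfolding z_def by (rule Q.infinitesimal_plus[OF x y])
  have zw: "z \<in> mv_carrier ?Q" "w \<in> mv_carrier ?Q"
    using xy by (simp_all add: z_def w_def Q.closed)
  have "mv_le ?Q (mv_neg ?Q y) (mv_neg ?Q w)"
    using xy by (simp add: w_def Q.closed Q.neg_neg Q.le_plus)
  then have w: "mv_infinitesimal ?Q w"
    using Q.infinitesimal_le[OF y zw(2)] Q.neg_le_iff xy zw by blast
  obtain h where h: "h \<in> mv_hom ?Q ?Q"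
    and h_inl: "\<And>c. c \<in> mv_carrier Chang \<Longrightarrow> h (mv_inl Chang Chang c) = mv_inl Chang Chang c"
    and h_inr: "\<And>c. c \<in> mv_carrier Chang \<Longrightarrow> h (mv_inr Chang Chang c) = chang_map ?Q z c"
    using mv_coprod_universal[OF mv_algebra_coprod inl Q.chang_map_hom[OF z]] by blast
  obtain g where g: "g \<in> mv_hom ?Q ?Q"
    and g_inl: "\<And>c. c \<in> mv_carrier Chang \<Longrightarrow> g (mv_inl Chang Chang c) = mv_inl Chang Chang c"
    and g_inr: "\<And>c. c \<in> mv_carrier Chang \<Longrightarrow> g (mv_inr Chang Chang c) = chang_map ?Q w c"
    using mv_coprod_universal[OF mv_algebra_coprod inl Q.chang_map_hom[OF w]] by blast
  \<comment> \<open>A map with \<open>x \<mapsto> Lex 0 1\<close> and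
    \<open>y \<mapsto> Lex 0 0\<close>, which will show that \<open>d\<close> is nonzero.\<close>
  obtain k where k: "k \<in> mv_hom ?Q Chang"
    and k_inl: "\<And>c. c \<in> mv_carrier Chang \<Longrightarrow> k (mv_inl Chang Chang c) = c"
    and k_inr: "\<And>c. c \<in> mv_carrier Chang \<Longrightarrow> k (mv_inr Chang Chang c) = chang_map Chang (Lex 0 0) c"
    using mv_coprod_universal[OF mv_algebra_Chang mv_hom_id C.chang_map_hom[OF C.infinitesimal_zero]]
    by auto
  have hx: "h x = x" using h_inl e by (simp add: x_def)
  have hy: "h y = z" using h_inr[OF e] zw by (simp add: y_def Q.plus_zero)
  have le: "mv_le ?Q y (mv_neg ?Q x)"
    using Q.infinitesimal_mult2[OF y x, of 1 1] xy by (simp add: Q.plus_zero)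
  have hw: "h w = y"
  proof -
    have "h w = mv_neg ?Q (mv_plus ?Q (mv_neg ?Q (mv_plus ?Q y x)) x)"
      using xy by (simp add: w_def mv_homD[OF h] Q.closed hx hy z_def Q.plus_comm)
    also have "\<dots> = y" using Q.neg_plus_cancel[OF xy(2,1) le] xy by (simp add: Q.neg_neg)
    finally show ?thesis .
  qed
  have "h (g p) = p" if "p \<in> mv_carrier ?Q" for p
  proof (rule mv_coprod_unique[OF mv_hom_comp[OF h g] mv_hom_id _ _ that])
    show "h (g (mv_inl Chang Chang c)) = mv_inl Chang Chang c" if "c \<in> mv_carrier Chang" for c
      using that by (simp add: g_inl h_inl)
    show "h (g (mv_inr Chang Chang c)) = mv_inr Chang Chang c" if "c \<in> mv_carrier Chang" for c
    proof -
      have "h (g (mv_inr Chang Chang c)) = chang_map ?Q (h w) c"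
        using chang_map_hom_apply[OF h mv_algebra_coprod zw(2)] by (simp only: g_inr[OF that])
      also have "\<dots> = mv_inr Chang Chang c"
        unfolding hw y_def by (rule Chang_hom_eq[OF inr that, symmetric])
      finally show ?thesis .
    qed
  qed
  then have onto: "mv_carrier ?Q \<subseteq> h ` mv_carrier ?Q"
    using mv_homD(1)[OF g] by (metis image_eqI subsetI)
  define d where "d = mv_neg ?Q (mv_plus ?Q (mv_neg ?Q x) y)"
  have d: "d \<in> mv_carrier ?Q" using xy by (simp add: d_def Q.closed)
  have "h d = mv_neg ?Q (mv_plus ?Q (mv_plus ?Q (mv_neg ?Q x) x) y)"
    using xy by (simp add: d_def mv_homD[OF h] Q.closed hx hy z_def Q.plus_assoc)
  also have "\<dots> = mv_zero ?Q" using xy by (simp add: Q.neg_plus Q.basic)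
  finally have hd: "h d = h (mv_zero ?Q)" by (simp add: mv_homD(2)[OF h])
  have "k d = ?e"
    using xy k_inl[OF e] k_inr[OF e]
    by (simp add: d_def mv_homD[OF k] Q.closed x_def[symmetric] y_def[symmetric] min_def)
  then have "d \<noteq> mv_zero ?Q" using mv_homD(2)[OF k] by auto
  then show ?thesis
    using not_hopfian_isomorphicI[OF P h onto d Q.zero_closed _ hd] by blast
qed


section \<open>Countable boolean algebras as fields of sets\<close>

context boolean_mv_algebra
begin

text \<open>The points of the Stone space. The clauses say that membership in \<open>U\<close> is a
  homomorphism to the two-element algebra, which is the form used for the representation.\<close>

definition ultras :: "'a set set" where
  "ultras = {U. U \<subseteq> mv_carrier A \<and> \<zero> \<notin> U \<and>
     (\<forall>x\<in>mv_carrier A. \<sim> x \<in> U \<longleftrightarrow> x \<notin> U) \<and>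
     (\<forall>x\<in>mv_carrier A. \<forall>y\<in>mv_carrier A. x \<oplus> y \<in> U \<longleftrightarrow> x \<in> U \<or> y \<in> U)}"

text \<open>A cut rule: replacing \<open>b\<close> by the larger \<open>\<sim> m\<close> in
  \<open>b \<oplus> z\<close> leaves \<open>\<sim> m\<close> twice, and idempotence merges the
  copies.\<close>

lemma boolean_cut:
  assumes c: "m \<in> mv_carrier A" "b \<in> mv_carrier A" "z \<in> mv_carrier A"
    and "m \<preceq> \<sim> b" "m \<preceq> b \<oplus> z"
  shows "m \<preceq> z"
proof -
  have "b \<preceq> \<sim> m" using assms le_neg_comm by blast
  then have "b \<oplus> z \<preceq> \<sim> m \<oplus> z" using c by (simp add: plus_mono closed)
  then have "m \<preceq> \<sim> m \<oplus> z" using assms le_trans[of m "b \<oplus> z" "\<sim> m \<oplus> z"] by (simp add: closed)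
  then have "(\<sim> m \<oplus> \<sim> m) \<oplus> z = \<one>" using c by (simp add: mv_le_def closed plus_assoc)
  then show ?thesis using c by (simp add: mv_le_def plus_idem closed)
qed

lemma boolean_disjoint:
  assumes "m \<in> mv_carrier A" "b \<in> mv_carrier A" "m \<preceq> b" "m \<preceq> \<sim> b"
  shows "m = \<zero>"
proof -
  have "m \<preceq> \<zero>" using boolean_cut[of m b \<zero>] assms by (simp add: basic)
  then have "\<sim> \<sim> m = \<sim> \<one>" using assms by (simp add: mv_le_def basic)
  then show ?thesis using assms by (simp add: basic)
qed

lemma times_zero_iff:
  "x \<in> mv_carrier A \<Longrightarrow> y \<in> mv_carrier A \<Longrightarrow> x \<odot> y = \<zero> \<longleftrightarrow> x \<preceq> \<sim> y"
  unfolding mv_le_def by (metis neg_neg neg_closed plus_closed zero_closed)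

lemma times_le:
  "x \<in> mv_carrier A \<Longrightarrow> y \<in> mv_carrier A \<Longrightarrow> x \<odot> y \<preceq> x"
  "x \<in> mv_carrier A \<Longrightarrow> y \<in> mv_carrier A \<Longrightarrow> x \<odot> y \<preceq> y"
  using neg_le_iff[of "\<sim> x \<oplus> \<sim> y" "\<sim> x"] le_plus[of "\<sim> x" "\<sim> y"]
    neg_le_iff[of "\<sim> x \<oplus> \<sim> y" "\<sim> y"] le_plus[of "\<sim> y" "\<sim> x"]
  by (metis closed(2,3) neg_neg neg_le_iff plus_comm)+

text \<open>Enumerate the carrier and decide its elements one by one below \<open>a\<close>; the
  upward closure of the resulting sequence is the ultrafilter.\<close>

lemma ex_ultra:
  assumes cnt: "countable (mv_carrier A)" and a: "a \<in> mv_carrier A" "a \<noteq> \<zero>"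
  shows "\<exists>U\<in>ultras. a \<in> U"
proof -
  let ?C = "mv_carrier A"
  have ne: "?C \<noteq> {}" using a by blast
  define c where "c = from_nat_into ?C"
  have c: "c n \<in> ?C" for n using ne by (simp add: c_def from_nat_into)
  have c_surj: "\<exists>n. x = c n" if "x \<in> ?C" for x
    using that cnt ne by (metis c_def from_nat_into_surj)
  \<comment> \<open>a descending sequence of nonzero elements that decides every element \<open>c n\<close>\<close>
  define m where "m = rec_nat a (\<lambda>n x. if x \<odot> c n \<noteq> \<zero> then x \<odot> c n else x \<odot> \<sim> c n)"
  have m0: "m 0 = a" and mS: "m (Suc n) = (if m n \<odot> c n \<noteq> \<zero> then m n \<odot> c n else m n \<odot> \<sim> c n)" for n
    by (simp_all add: m_def)
  have m: "m n \<in> ?C" for n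
    by (induction n) (use a c in \<open>simp_all add: m0 mS closed\<close>)
  have m_ne: "m n \<noteq> \<zero>" for n
  proof (induction n)
    case (Suc n)
    have "m n \<odot> \<sim> c n \<noteq> \<zero>" if "m n \<odot> c n = \<zero>"
      using that boolean_disjoint[OF m c, of n n] Suc times_zero_iff[OF m c, of n n]
        times_zero_iff[OF m neg_closed[OF c], of n n] neg_neg[OF c] by metis
    then show ?case by (simp add: mS)
  qed (simp add: m0 a)
  have m_Suc: "m (Suc n) \<preceq> m n" for n
    using times_le(1)[OF m[of n] c[of n]] times_le(1)[OF m[of n] neg_closed[OF c[of n]]]
    by (simp add: mS)
  have m_decide: "m (Suc n) \<preceq> c n \<or> m (Suc n) \<preceq> \<sim> c n" for n
    using times_le(2)[OF m[of n] c[of n]] times_le(2)[OF m[of n] neg_closed[OF c[of n]]]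
    by (simp add: mS)
  have m_mono: "m (k + n) \<preceq> m n" for k n
  proof (induction k)
    case (Suc k)
    then show ?case using le_trans[OF m[of "Suc k + n"] m[of "k + n"] m[of n]] m_Suc[of "k + n"] by simp
  qed (simp add: le_refl m)
  define U where "U = {b \<in> ?C. \<exists>n. m n \<preceq> b}"
  have UI: "m i \<preceq> b \<Longrightarrow> b \<in> ?C \<Longrightarrow> b \<in> U" for i b by (auto simp: U_def)
  have join: "\<exists>n. m n \<preceq> x \<and> m n \<preceq> y"
    if "m i \<preceq> x" "m j \<preceq> y" "x \<in> ?C" "y \<in> ?C" for i j x y
    using that m_mono[of j i] m_mono[of i j] m le_trans by (metis add.commute)
  have neg: "\<sim> x \<in> U \<longleftrightarrow> x \<notin> U" if x: "x \<in> ?C" for x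
  proof
    assume "\<sim> x \<in> U"
    then obtain i where i: "m i \<preceq> \<sim> x" by (auto simp: U_def)
    show "x \<notin> U"
    proof
      assume "x \<in> U"
      then obtain j where "m j \<preceq> x" by (auto simp: U_def)
      then obtain n where "m n \<preceq> x" "m n \<preceq> \<sim> x" using join[OF _ i x neg_closed[OF x]] by blast
      then show False using boolean_disjoint[OF m x] m_ne by blast
    qed
  next
    assume "x \<notin> U"
    moreover obtain n where "x = c n" using c_surj[OF x] by blast
    ultimately show "\<sim> x \<in> U"
      using m_decide[of n] x UI[of "Suc n" x] UI[of "Suc n" "\<sim> x"] neg_closed[OF x] by blast
  qed
  have "x \<oplus> y \<in> U \<longleftrightarrow> x \<in> U \<or> y \<in> U" if xy: "x \<in> ?C" "y \<in> ?C" for x y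
  proof
    have "x \<oplus> y \<in> U" if "m i \<preceq> x \<or> m i \<preceq> y" for i
      using that le_plus[of x y] le_plus[of y x] le_trans[OF m, of x "x \<oplus> y" i]
        le_trans[OF m, of y "x \<oplus> y" i] xy UI[of i "x \<oplus> y"] plus_comm[of x y]
      by (auto simp: plus_closed)
    moreover assume "x \<in> U \<or> y \<in> U"
    ultimately show "x \<oplus> y \<in> U" by (auto simp: U_def)
  next
    assume "x \<oplus> y \<in> U"
    then obtain i where i: "m i \<preceq> x \<oplus> y" by (auto simp: U_def)
    show "x \<in> U \<or> y \<in> U"
    proof (cases "x \<in> U")
      case False
      then have "\<sim> x \<in> U" using neg xy by blast
      then obtain j where "m j \<preceq> \<sim> x" by (auto simp: U_def)
      then obtain n where "m n \<preceq> \<sim> x" "m n \<preceq> x \<oplus> y"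
        using join[OF _ i neg_closed[OF xy(1)] plus_closed[OF xy]] by blast
      \<comment> \<open>Primeness: \<open>m n\<close> lies below \<open>\<sim> x\<close> and
        \<open>x \<oplus> y\<close>, so the cut puts it below \<open>y\<close>.\<close>
      then show ?thesis using boolean_cut[OF m xy] UI xy by blast
    qed simp
  qed
  moreover have "\<zero> \<notin> U"
    using neg[of \<zero>] UI[of 0 \<one>] m[of 0] by (simp add: closed mv_le_def plus_top)
  ultimately have "U \<in> ultras" using neg by (auto simp: ultras_def U_def)
  moreover have "a \<in> U" using UI[of 0 a] a le_refl by (simp add: m0)
  ultimately show ?thesis by blast
qed

text \<open>Stone representation, with \<open>r\<close> the Stone map. It is injective because
  \<open>a \<odot> \<sim> b\<close> is nonzero when \<open>a \<preceq> b\<close> fails, and an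
  ultrafilter containing it contains \<open>a\<close> but not \<open>b\<close>.\<close>

lemma set_representation:
  assumes cnt: "countable (mv_carrier A)"
  obtains S F where "algebra (S :: 'a set set) F"
    and "\<And>x y. x \<in> S \<Longrightarrow> y \<in> S \<Longrightarrow> x \<noteq> y \<Longrightarrow> \<exists>b\<in>F. x \<in> b \<and> y \<notin> b"
    and "mv_isomorphic A (set_mv S F)"
proof
  let ?C = "mv_carrier A"
  define r where "r b = {U \<in> ultras. b \<in> U}" for b
  have r0: "r \<zero> = {}" by (auto simp: r_def ultras_def)
  have rneg: "r (\<sim> x) = ultras - r x" if "x \<in> ?C" for x
    using that by (auto simp: r_def ultras_def)
  have rplus: "r (x \<oplus> y) = r x \<union> r y" if "x \<in> ?C" "y \<in> ?C" for x y
    using that by (auto simp: r_def ultras_def)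
  show "algebra ultras (r ` ?C)"
    unfolding algebra_iff_Un
  proof (intro conjI ballI)
    show "r ` ?C \<subseteq> Pow ultras" by (auto simp: r_def)
    show "{} \<in> r ` ?C" using r0 zero_closed by (metis image_eqI)
    show "ultras - b \<in> r ` ?C" if "b \<in> r ` ?C" for b
      using that by (auto simp flip: rneg intro!: imageI neg_closed)
    show "b \<union> c \<in> r ` ?C" if "b \<in> r ` ?C" "c \<in> r ` ?C" for b c
      using that by (auto simp flip: rplus intro!: imageI plus_closed)
  qed
  show "\<exists>b\<in>r ` ?C. x \<in> b \<and> y \<notin> b" if xy: "x \<in> ultras" "y \<in> ultras" "x \<noteq> y" for x y
  proof -
    have sub: "x \<subseteq> ?C" "y \<subseteq> ?C" using xy by (auto simp: ultras_def)
    consider b where "b \<in> x" "b \<notin> y" | b where "b \<in> y" "b \<notin> x" using xy by blast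
    then show ?thesis
    proof cases
      case 1
      then show ?thesis using xy sub by (intro bexI[of _ "r b"]) (auto simp: r_def)
    next
      case 2
      then have "b \<in> ?C" using sub by blast
      then show ?thesis using 2 xy
        by (intro bexI[of _ "r (\<sim> b)"]) (auto simp: r_def ultras_def neg_closed)
    qed
  qed
  have le: "a \<preceq> b" if ab: "r a = r b" "a \<in> ?C" "b \<in> ?C" for a b
  proof (rule ccontr)
    assume "\<not> a \<preceq> b"
    then have "a \<odot> \<sim> b \<noteq> \<zero>" using ab times_zero_iff[of a "\<sim> b"] by (simp add: basic)
    then obtain U where U: "U \<in> ultras" "a \<odot> \<sim> b \<in> U"
      using ex_ultra[OF cnt, of "a \<odot> \<sim> b"] ab by (auto simp: closed)
    then have "a \<in> U \<and> b \<notin> U" using ab by (simp add: ultras_def basic)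
    then show False using U ab by (auto simp: r_def)
  qed
  have "inj_on r ?C" using le le_antisym by (metis inj_onI)
  then have "r \<in> mv_iso A (set_mv ultras (r ` ?C))"
    using r0 rneg rplus by (simp add: mv_iso_def mv_hom_def bij_betw_def)
  then show "mv_isomorphic A (set_mv ultras (r ` ?C))" by (auto simp: mv_isomorphic_def)
qed

end


section \<open>Countably infinite boolean algebras\<close>

text \<open>Singletons in \<open>F\<close> are the isolated points, and a member of \<open>F\<close>
  may be altered at finitely many of them.\<close>

lemma algebra_finite_diff:
  assumes "algebra S F" "b \<in> F" "finite ((b - c) \<union> (c - b))"
    and "\<And>x. x \<in> (b - c) \<union> (c - b) \<Longrightarrow> {x} \<in> F"
  shows "c \<in> F"
proof -
  interpret algebra S F by fact
  have fin: "(\<Union>x\<in>D. {x}) \<in> F" if "D \<subseteq> (b - c) \<union> (c - b)" for D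
    using finite_subset[OF that assms(3)] that assms(4) by (intro finite_UN) blast+
  have "c = (b - (\<Union>x\<in>b - c. {x})) \<union> (\<Union>x\<in>c - b. {x})" by auto
  also have "\<dots> \<in> F" by (intro Un Diff assms(2) fin) blast+
  finally show ?thesis .
qed

text \<open>A sequence of isolated points that converges in the Stone space can be shifted by one.\<close>

lemma shift_endomorphism:
  assumes alg: "algebra S F" and cnt: "countable F" and inf: "infinite {x \<in> S. {x} \<in> F}"
  shows "\<exists>h\<in>mv_hom (set_mv S F) (set_mv S F). F \<subseteq> h ` F \<and> (\<exists>a\<in>F. a \<noteq> {} \<and> h a = {})"
proof -
  interpret algebra S F by fact
  define c where "c = from_nat_into F"
  have c_surj: "\<exists>n. b = c n" if "b \<in> F" for b
    using that cnt by (metis c_def from_nat_into_surj)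
  \<comment> \<open>Shrinking infinite sets of isolated points, where \<open>K (Suc n)\<close> lies
    inside or outside \<open>c n\<close>. Distinct \<open>s n\<close> chosen from \<open>K n\<close>
    are eventually inside or eventually outside each member of \<open>F\<close>, which is
    convergence without naming a limit.\<close>
  define K where "K = rec_nat {x \<in> S. {x} \<in> F}
    (\<lambda>n X. if infinite (X \<inter> c n) then X \<inter> c n else X - c n)"
  have K0: "K 0 = {x \<in> S. {x} \<in> F}"
    and KS: "K (Suc n) = (if infinite (K n \<inter> c n) then K n \<inter> c n else K n - c n)" for n
    by (simp_all add: K_def)
  have K_inf: "infinite (K n)" for n
  proof (induction n)
    case (Suc n)
    have "K n = (K n \<inter> c n) \<union> (K n - c n)" by blast
    then show ?case using Suc by (metis KS finite_UnI)
  qed (use inf in \<open>simp add: K0\<close>)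
  have K_anti: "antimono K" by (rule decseq_SucI) (auto simp: KS)
  have "\<exists>s. \<forall>n. s n \<in> K n \<and> (\<forall>i<n. s i \<noteq> s n)"
  proof -
    have "\<exists>s. \<forall>n. (\<lambda>s n x. x \<in> K n - s ` {..<n}) s n (s n)"
    proof (rule dependent_wellorder_choice)
      show "\<exists>r. r \<in> K n - s ` {..<n}" for n and s :: "nat \<Rightarrow> _"
        using K_inf[of n] by (metis finite_imageI finite_lessThan Diff_infinite_finite
            infinite_imp_nonempty ex_in_conv)
      show "r \<in> K n - f ` {..<n} \<longleftrightarrow> r \<in> K n - g ` {..<n}"
        if "\<And>i. i < n \<Longrightarrow> f i = g i" for r n and f g :: "nat \<Rightarrow> _"
        using that by auto
    qed
    then show ?thesis by (metis DiffE imageI lessThan_iff)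
  qed
  then obtain s where sK: "\<And>n. s n \<in> K n" and s_ne: "\<And>i n. i < n \<Longrightarrow> s i \<noteq> s n" by blast
  have s_inj: "s i = s j \<longleftrightarrow> i = j" for i j using s_ne by (metis nat_neq_iff)
  have s0: "s n \<in> S" "{s n} \<in> F" for n
    using sK[of n] antimonoD[OF K_anti, of 0 n] by (auto simp: K0)
  have conv: "\<exists>m. \<forall>n\<ge>m. s n \<in> b \<longleftrightarrow> s (Suc n) \<in> b" if b: "b \<in> F" for b
  proof -
    obtain m where m: "b = c m" using c_surj[OF b] by blast
    have "s n \<in> b \<longleftrightarrow> infinite (K m \<inter> c m)" if "n \<ge> Suc m" for n
      using sK[of n] antimonoD[OF K_anti that] by (auto simp: KS m split: if_splits)
    then show ?thesis by (metis le_SucI)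
  qed
  define f where "f x = (if x \<in> range s then s (Suc (inv s x)) else x)" for x
  have fs: "f (s n) = s (Suc n)" for n
    using s_inj by (simp add: f_def inv_f_f inj_def)
  have f_id: "f x = x" if "x \<notin> range s" for x using that by (simp add: f_def)
  have f_eq: "f x = f y \<longleftrightarrow> x = y" for x y
    by (cases "x \<in> range s"; cases "y \<in> range s") (auto simp: fs f_id s_inj)
  have f_mem: "f x \<in> f ` b \<longleftrightarrow> x \<in> b" for x b by (auto simp: f_eq)
  have fS: "f x \<in> S \<longleftrightarrow> x \<in> S" for x
    by (cases "x \<in> range s") (auto simp: fs f_id s0)
  \<comment> \<open>The preimage map of the shift \<open>f\<close>. By \<open>conv\<close>, it
    changes a member of \<open>F\<close> at only finitely many points of the sequence.\<close>
  define h where "h b = {x \<in> S. f x \<in> b}" for b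
  have small: "c \<in> F" if b: "b \<in> F" and sub: "(b - c) \<union> (c - b) \<subseteq> s ` N" and N: "finite N" for b c N
  proof (rule algebra_finite_diff[OF alg b])
    show "finite ((b - c) \<union> (c - b))" by (rule finite_subset[OF sub finite_imageI[OF N]])
    show "{x} \<in> F" if "x \<in> (b - c) \<union> (c - b)" for x
      using subsetD[OF sub that] s0(2) by auto
  qed
  have hF: "h b \<in> F" if b: "b \<in> F" for b
  proof -
    obtain m where m: "\<And>n. n \<ge> m \<Longrightarrow> s n \<in> b \<longleftrightarrow> s (Suc n) \<in> b" using conv[OF b] by blast
    show ?thesis
    proof (rule small[OF b])
      show "(b - h b) \<union> (h b - b) \<subseteq> s ` {..<m}"
      proof
        fix x assume x: "x \<in> (b - h b) \<union> (h b - b)"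
        then have xS: "x \<in> S" using sets_into_space[OF b] by (auto simp: h_def)
        have "x \<in> range s"
        proof (rule ccontr)
          assume "x \<notin> range s"
          then have "f x = x" by (rule f_id)
          then show False using x xS by (auto simp: h_def)
        qed
        then obtain n where n: "x = s n" by blast
        then have "n < m" using x xS m[of n] by (cases "n < m") (auto simp: h_def fs)
        then show "x \<in> s ` {..<m}" using n by blast
      qed
    qed simp
  qed
  have hom: "h \<in> mv_hom (set_mv S F) (set_mv S F)"
    using hF by (auto simp: mv_hom_def h_def fS)
  have onto: "b \<in> h ` F" if b: "b \<in> F" for b
  proof -
    obtain m where m: "\<And>n. n \<ge> m \<Longrightarrow> s n \<in> b \<longleftrightarrow> s (Suc n) \<in> b" using conv[OF b] by blast
    have "f ` b \<in> F"
    proof (rule small[OF b])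
      \<comment> \<open>The bound is \<open>m\<close> inclusive, unlike for \<open>h b\<close>:
        \<open>s (Suc k)\<close> is compared with its predecessor \<open>s k\<close>, and
        \<open>s 0\<close> has none.\<close>
      show "(b - f ` b) \<union> (f ` b - b) \<subseteq> s ` {..m}"
      proof
        fix x assume x: "x \<in> (b - f ` b) \<union> (f ` b - b)"
        have "x \<in> range s"
        proof (rule ccontr)
          assume "x \<notin> range s"
          then have "f x = x" by (rule f_id)
          then show False using x f_mem[of x b] by auto
        qed
        then obtain n where n: "x = s n" by blast
        have "n \<le> m"
        proof (rule ccontr)
          assume "\<not> n \<le> m"
          then obtain k where k: "n = Suc k" "k \<ge> m" by (cases n) auto
          have "s n \<in> f ` b \<longleftrightarrow> s k \<in> b" using f_mem[of "s k" b] fs[of k] k by simp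
          then show False using x n k m[of k] by auto
        qed
        then show "x \<in> s ` {..m}" using n by blast
      qed
    qed simp
    moreover have "h (f ` b) = b" using sets_into_space[OF b] by (auto simp: h_def f_mem)
    ultimately show ?thesis by (metis image_eqI)
  qed
  have "f x \<noteq> s 0" for x
    by (cases "x \<in> range s") (auto simp: fs f_id s_inj)
  then have "h {s 0} = {}" by (simp add: h_def)
  then have "\<exists>a\<in>F. a \<noteq> {} \<and> h a = {}" using s0(2) by (intro bexI[of _ "{s 0}"]) simp_all
  then show ?thesis using hom onto by (intro bexI[of _ h] conjI subsetI)
qed

text \<open>The atomless part \<open>D\<close> is split along a binary tree \<open>t\<close> that decides every member of \<open>F\<close> at some
  level. Nodes are lists with the most recent choice first, so \<open>u @ [False]\<close> prefixes the address
  \<open>u\<close> with \<open>False\<close>, and \<open>h\<close> is the preimage map of this prefixing.\<close>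

lemma tree_endomorphism:
  assumes alg: "algebra S F" and cnt: "countable F" and inf: "infinite F"
    and sep: "\<And>x y. x \<in> S \<Longrightarrow> y \<in> S \<Longrightarrow> x \<noteq> y \<Longrightarrow> \<exists>b\<in>F. x \<in> b \<and> y \<notin> b"
    and fin: "finite {x \<in> S. {x} \<in> F}"
  shows "\<exists>h\<in>mv_hom (set_mv S F) (set_mv S F). F \<subseteq> h ` F \<and> (\<exists>a\<in>F. a \<noteq> {} \<and> h a = {})"
proof -
  interpret algebra S F by fact
  define c where "c = from_nat_into F"
  have cF: "c n \<in> F" for n unfolding c_def using inf by (intro from_nat_into) auto
  have c_surj: "\<exists>n. b = c n" if "b \<in> F" for b
    using that cnt by (metis c_def from_nat_into_surj)
  define E where "E = {x \<in> S. {x} \<in> F}"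
  define D where "D = S - E"
  have EF: "E \<in> F"
    by (rule algebra_finite_diff[OF alg empty_sets]) (use fin in \<open>auto simp: E_def\<close>)
  then have DF: "D \<in> F" by (auto simp: D_def)
  have ED: "E \<inter> D = {}" "E \<union> D = S" by (auto simp: D_def E_def)
  have "D \<noteq> {}"
  proof
    assume "D = {}"
    then have "finite S" using ED fin by (simp add: E_def)
    then show False using inf space_closed by (metis finite_Pow_iff finite_subset)
  qed
  \<comment> \<open>A nonempty member inside \<open>D\<close> cannot be a singleton, whose point
    would lie in \<open>E\<close>; a set separating two of its points cuts it.\<close>
  have split: "\<exists>p\<in>F. p \<subseteq> b \<and> p \<noteq> {} \<and> p \<noteq> b" if b: "b \<in> F" "b \<subseteq> D" "b \<noteq> {}" for b
  proof -
    obtain x where x: "x \<in> b" using b by blast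
    then have "b \<noteq> {x}" using b by (auto simp: D_def E_def)
    then obtain y where y: "y \<in> b" "x \<noteq> y" using x by blast
    then obtain d where "d \<in> F" "x \<in> d" "y \<notin> d" using sep[of x y] x b D_def by blast
    then show ?thesis using x y b by (intro bexI[of _ "b \<inter> d"]) auto
  qed
  \<comment> \<open>Cut by \<open>c n\<close> if that is a proper cut. Otherwise \<open>b\<close>
    already decides \<open>c n\<close>, and any proper cut will do to keep the tree
    branching.\<close>
  define sp where "sp n b = (if b \<inter> c n \<noteq> {} \<and> b - c n \<noteq> {} then b \<inter> c n
    else (SOME p. p \<in> F \<and> p \<subseteq> b \<and> p \<noteq> {} \<and> p \<noteq> b))" for n b
  have sp: "sp n b \<in> F" "sp n b \<subseteq> b" "sp n b \<noteq> {}" "sp n b \<noteq> b"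
    if b: "b \<in> F" "b \<subseteq> D" "b \<noteq> {}" for n b
  proof -
    have "sp n b \<in> F \<and> sp n b \<subseteq> b \<and> sp n b \<noteq> {} \<and> sp n b \<noteq> b"
    proof (cases "b \<inter> c n \<noteq> {} \<and> b - c n \<noteq> {}")
      case True
      then show ?thesis using b cF[of n] by (auto simp: sp_def)
    next
      case False
      then have "sp n b = (SOME p. p \<in> F \<and> p \<subseteq> b \<and> p \<noteq> {} \<and> p \<noteq> b)" by (simp only: sp_def if_False)
      then show ?thesis using someI_ex[of "\<lambda>p. p \<in> F \<and> p \<subseteq> b \<and> p \<noteq> {} \<and> p \<noteq> b"] split[OF b] by auto
    qed
    then show "sp n b \<in> F" "sp n b \<subseteq> b" "sp n b \<noteq> {}" "sp n b \<noteq> b" by auto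
  qed
  define t :: "bool list \<Rightarrow> _" where "t = rec_list D
    (\<lambda>x u b. if x then sp (length u) b else b - sp (length u) b)"
  have t_Nil: "t [] = D"
    and t_Cons: "t (x # u) = (if x then sp (length u) (t u) else t u - sp (length u) (t u))" for x u
    by (simp_all add: t_def)
  have t: "t u \<in> F \<and> t u \<subseteq> D \<and> t u \<noteq> {}" for u
  proof (induction u)
    case (Cons x u)
    then show ?case using sp[of "t u" "length u"] by (auto simp: t_Cons)
  qed (use DF \<open>D \<noteq> {}\<close> in \<open>simp add: t_Nil\<close>)
  then have tF: "t u \<in> F" and tD: "t u \<subseteq> D" and t_ne: "t u \<noteq> {}" for u by auto
  have t_sub1: "t (x # u) \<subseteq> t u" for x u
    using sp(2)[OF tF tD t_ne, of "length u" u] by (auto simp: t_Cons)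
  have t_sub: "t (v @ u) \<subseteq> t u" for v u
  proof (induction v)
    case (Cons x v)
    then show ?case using t_sub1[of x "v @ u"] by simp
  qed simp
  have t_uniq: "u = v" if "x \<in> t u" "x \<in> t v" "length u = length v" for x u v
    using that(3,1,2)
  proof (induction u v rule: list_induct2)
    case (Cons y u z v)
    then have "u = v" using t_sub1 by blast
    then show ?case using Cons by (auto simp: t_Cons split: if_splits)
  qed simp
  have t_cover: "\<exists>u. length u = n \<and> x \<in> t u" if x: "x \<in> D" for x n
  proof (induction n)
    case (Suc n)
    then obtain u where "length u = n" "x \<in> t u" by blast
    then show ?case
      by (intro exI[of _ "(x \<in> sp (length u) (t u)) # u"]) (auto simp: t_Cons)
  qed (use x in \<open>simp add: t_Nil\<close>)
  have t_decide: "\<exists>m. \<forall>u. length u \<ge> m \<longrightarrow> t u \<subseteq> b \<or> t u \<inter> b = {}" if b: "b \<in> F" for b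
  proof -
    obtain m where m: "b = c m" using c_surj[OF b] by blast
    have "t u \<subseteq> b \<or> t u \<inter> b = {}" if "length u \<ge> Suc m" for u
    proof -
      \<comment> \<open>The address of the ancestor at level \<open>Suc m\<close>, the first level
        at which \<open>c m\<close> is decided; older choices stand at the end of the list.\<close>
      define w where "w = drop (length u - Suc m) u"
      have w: "u = take (length u - Suc m) u @ w" "length w = Suc m" using that by (simp_all add: w_def)
      then obtain x v where v: "w = x # v" "length v = m" by (auto simp: length_Suc_conv)
      have "t w \<subseteq> b \<or> t w \<inter> b = {}"
      proof (cases "t v \<inter> c m \<noteq> {} \<and> t v - c m \<noteq> {}")
        case True
        then show ?thesis by (auto simp: v t_Cons m sp_def)
      next
        case False
        then show ?thesis using t_sub1[of x v] unfolding v m by blast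
      qed
      then show ?thesis using t_sub w(1) by (metis subset_trans disjoint_iff subset_iff)
    qed
    then show ?thesis by blast
  qed
  \<comment> \<open>Expressed by nodes instead of points, since an infinite branch of the tree need
    not contain a point of \<open>S\<close>. The isolated points stay fixed.\<close>
  define h where "h b = (b \<inter> E) \<union> \<Union>{t u | u. t (u @ [False]) \<subseteq> b}" for b
  have h_sub: "h b \<subseteq> S" for b using tD ED by (auto simp: h_def)
  have h_E: "x \<in> h b \<longleftrightarrow> x \<in> b" if "x \<in> E" for x b
    using that tD ED by (auto simp: h_def)
  have suffix: "\<exists>z. v = z @ u" if "x \<in> t u" "x \<in> t v" "length u \<le> length v" for x u v
  proof -
    let ?k = "length v - length u"
    have "x \<in> t (drop ?k v)" using that(2) t_sub[of "take ?k v" "drop ?k v"] by auto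
    then have "u = drop ?k v" using that by (intro t_uniq[of x]) auto
    then show ?thesis by (metis append_take_drop_id)
  qed
  \<comment> \<open>Deep nodes are decided by \<open>b\<close>, so containment and intersection are
    equivalent tests. Having both is what makes \<open>h\<close> commute with complement and
    union.\<close>
  have h_D: "\<exists>m. \<forall>u x. length u \<ge> m \<longrightarrow> x \<in> t u \<longrightarrow>
      (x \<in> h b \<longleftrightarrow> t (u @ [False]) \<subseteq> b) \<and> (x \<in> h b \<longleftrightarrow> t (u @ [False]) \<inter> b \<noteq> {})"
    if b: "b \<in> F" for b
  proof -
    obtain m where m: "\<And>u. length u \<ge> m \<Longrightarrow> t u \<subseteq> b \<or> t u \<inter> b = {}" using t_decide[OF b] by blast
    have "(x \<in> h b \<longleftrightarrow> t (u @ [False]) \<subseteq> b) \<and> (x \<in> h b \<longleftrightarrow> t (u @ [False]) \<inter> b \<noteq> {})"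
      if u: "length u \<ge> m" "x \<in> t u" for u x
    proof -
      have dec: "t (u @ [False]) \<subseteq> b \<or> t (u @ [False]) \<inter> b = {}" using m u by simp
      have "x \<in> h b \<longleftrightarrow> t (u @ [False]) \<subseteq> b"
      proof
        assume "t (u @ [False]) \<subseteq> b"
        then show "x \<in> h b" using u by (auto simp: h_def)
      next
        assume "x \<in> h b"
        moreover have "x \<notin> E" using u tD ED by blast
        ultimately obtain v where v: "x \<in> t v" "t (v @ [False]) \<subseteq> b" by (auto simp: h_def)
        show "t (u @ [False]) \<subseteq> b"
        proof (cases "length u \<le> length v")
          case True
          then obtain z where "v = z @ u" using suffix u v by blast
          then have "t (v @ [False]) \<subseteq> t (u @ [False])" using t_sub[of z "u @ [False]"] by simp
          then show ?thesis using dec v(2) t_ne[of "v @ [False]"] by blast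
        next
          case False
          then obtain z where "u = z @ v" using suffix[OF v(1) u(2)] by auto
          then show ?thesis using t_sub[of z "v @ [False]"] v(2) by simp
        qed
      qed
      then show ?thesis using dec t_ne[of "u @ [False]"] by blast
    qed
    then show ?thesis by blast
  qed
  have fin_lists: "finite {u :: bool list. length u = n}" for n
    using finite_lists_length_eq[of "UNIV :: bool set" n] by simp
  have level: "\<Union>{t (g u) | u. length u = n \<and> Q u} \<in> F" for n Q and g :: "bool list \<Rightarrow> bool list"
  proof -
    have "\<Union>{t (g u) | u. length u = n \<and> Q u} = (\<Union>u\<in>{u. length u = n \<and> Q u}. t (g u))" by blast
    also have "\<dots> \<in> F"
      using tF finite_subset[OF _ fin_lists[of n]] by (intro finite_UN) auto
    finally show ?thesis .
  qed
  have hF: "h b \<in> F" if b: "b \<in> F" for b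
  proof -
    obtain m where m: "\<And>u x. length u \<ge> m \<Longrightarrow> x \<in> t u \<Longrightarrow> x \<in> h b \<longleftrightarrow> t (u @ [False]) \<subseteq> b"
      using h_D[OF b] by blast
    \<comment> \<open>One sufficiently deep level determines \<open>h b\<close>, so the union in its
      definition may be taken over finitely many nodes.\<close>
    have "h b = (b \<inter> E) \<union> \<Union>{t u | u. length u = m \<and> t (u @ [False]) \<subseteq> b}" (is "_ = ?R")
    proof (intro set_eqI iffI)
      fix x assume x: "x \<in> h b"
      show "x \<in> ?R"
      proof (cases "x \<in> E")
        case False
        then have "x \<in> D" using x h_sub ED by blast
        then obtain u where "length u = m" "x \<in> t u" using t_cover by blast
        then show ?thesis using m[of u x] x by auto
      qed (use x h_E in auto)
    qed (auto simp: h_def)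
    then show ?thesis using b EF level[of "\<lambda>u. u" m] by auto
  qed
  have h_neg: "h (S - b) = S - h b" if b: "b \<in> F" for b
  proof (rule set_eqI)
    fix x
    obtain m where m: "\<And>u x. length u \<ge> m \<Longrightarrow> x \<in> t u \<Longrightarrow> x \<in> h b \<longleftrightarrow> t (u @ [False]) \<inter> b \<noteq> {}"
      using h_D[OF b] by blast
    obtain k where k: "\<And>u x. length u \<ge> k \<Longrightarrow> x \<in> t u \<Longrightarrow> x \<in> h (S - b) \<longleftrightarrow> t (u @ [False]) \<subseteq> S - b"
      using h_D[OF compl_sets[OF b]] by blast
    consider "x \<in> E" | "x \<in> D" | "x \<notin> S" using ED by blast
    then show "x \<in> h (S - b) \<longleftrightarrow> x \<in> S - h b"
    proof cases
      case 1
      then show ?thesis using h_E ED by auto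
    next
      case 2
      then obtain u where u: "length u = max m k" "x \<in> t u" using t_cover by blast
      have "t (u @ [False]) \<subseteq> S" using tF sets_into_space by blast
      then show ?thesis using 2 u m[of u x] k[of u x] ED by auto
    next
      case 3
      then show ?thesis using h_sub by blast
    qed
  qed
  have h_un: "h (a \<union> b) = h a \<union> h b" if ab: "a \<in> F" "b \<in> F" for a b
  proof (rule set_eqI)
    fix x
    obtain k where k: "\<And>u x. length u \<ge> k \<Longrightarrow> x \<in> t u \<Longrightarrow> x \<in> h a \<longleftrightarrow> t (u @ [False]) \<inter> a \<noteq> {}"
      using h_D[OF ab(1)] by blast
    obtain l where l: "\<And>u x. length u \<ge> l \<Longrightarrow> x \<in> t u \<Longrightarrow> x \<in> h b \<longleftrightarrow> t (u @ [False]) \<inter> b \<noteq> {}"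
      using h_D[OF ab(2)] by blast
    obtain m where m: "\<And>u x. length u \<ge> m \<Longrightarrow> x \<in> t u \<Longrightarrow>
        x \<in> h (a \<union> b) \<longleftrightarrow> t (u @ [False]) \<inter> (a \<union> b) \<noteq> {}"
      using h_D[OF Un[OF ab]] by blast
    consider "x \<in> E" | "x \<in> D" | "x \<notin> S" using ED by blast
    then show "x \<in> h (a \<union> b) \<longleftrightarrow> x \<in> h a \<union> h b"
    proof cases
      case 1
      then show ?thesis using h_E by auto
    next
      case 2
      then obtain u where u: "length u = max (max k l) m" "x \<in> t u" using t_cover by blast
      then show ?thesis using k[of u x] l[of u x] m[of u x] by auto
    next
      case 3
      then show ?thesis using h_sub by blast
    qed
  qed
  have h0: "h {} = {}" using t_ne by (auto simp: h_def)
  have hom: "h \<in> mv_hom (set_mv S F) (set_mv S F)"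
    by (simp add: mv_hom_def image_subset_iff hF h0 h_neg h_un)
  have onto: "b \<in> h ` F" if b: "b \<in> F" for b
  proof -
    obtain m where m: "\<And>u. length u \<ge> m \<Longrightarrow> t u \<subseteq> b \<or> t u \<inter> b = {}" using t_decide[OF b] by blast
    \<comment> \<open>The image of \<open>b\<close> under prefixing by \<open>False\<close>, formed
      at a level that decides \<open>b\<close>; it will satisfy \<open>h d = b\<close>.\<close>
    define d where "d = (b \<inter> E) \<union> \<Union>{t (u @ [False]) | u. length u = m \<and> t u \<subseteq> b}"
    have dF: "d \<in> F" unfolding d_def using b EF level[of "\<lambda>u. u @ [False]" m "\<lambda>u. t u \<subseteq> b"] by auto
    have "x \<in> h d \<longleftrightarrow> x \<in> b" for x
    proof -
      obtain k where k: "\<And>u x. length u \<ge> k \<Longrightarrow> x \<in> t u \<Longrightarrow>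
          (x \<in> h d \<longleftrightarrow> t (u @ [False]) \<subseteq> d) \<and> (x \<in> h d \<longleftrightarrow> t (u @ [False]) \<inter> d \<noteq> {})"
        using h_D[OF dF] by blast
      consider "x \<in> E" | "x \<in> D" | "x \<notin> S" using ED by blast
      then show ?thesis
      proof cases
        case 1
        then have "x \<notin> t u" for u using tD ED by blast
        then show ?thesis using h_E[OF 1] 1 by (auto simp: d_def)
      next
        case 2
        \<comment> \<open>Length \<open>m + k\<close> is deep enough to test \<open>d\<close>, and
          leaves an ancestor \<open>u\<close> at level \<open>m\<close> to test
          \<open>b\<close>.\<close>
        then obtain w where w: "length w = m + k" "x \<in> t w" using t_cover by blast
        define u where "u = drop k w"
        have wu: "w = take k w @ u" "length u = m" using w by (simp_all add: u_def)
        have xu: "x \<in> t u" using w t_sub wu(1) by (metis subsetD)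
        have sub: "t (w @ [False]) \<subseteq> t (u @ [False])"
          using t_sub[of "take k w" "u @ [False]"] wu(1) by (metis append_assoc)
        show ?thesis
        proof (cases "t u \<subseteq> b")
          case True
          then have "t (u @ [False]) \<subseteq> d" using wu(2) by (auto simp: d_def)
          then show ?thesis using sub k[of w x] w True xu by auto
        next
          case False
          then have "x \<notin> b" using m[of u] wu(2) xu by auto
          moreover have "t (u @ [False]) \<inter> d = {}"
          proof (rule ccontr)
            assume "t (u @ [False]) \<inter> d \<noteq> {}"
            then obtain y where y: "y \<in> t (u @ [False])" "y \<in> d" by blast
            then have "y \<notin> E" using tD ED by blast
            then obtain v where "y \<in> t (v @ [False])" "length v = m" "t v \<subseteq> b"
              using y by (auto simp: d_def)
            then show False using t_uniq[OF y(1), of "v @ [False]"] wu(2) False by simp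
          qed
          ultimately show ?thesis using sub k[of w x] w by auto
        qed
      next
        case 3
        then show ?thesis using h_sub b sets_into_space by blast
      qed
    qed
    then have "h d = b" by blast
    then show ?thesis using dF by blast
  qed
  \<comment> \<open>Every prefixed node is a nonempty part of \<open>t [False]\<close>, which is
    disjoint from \<open>t [True]\<close>.\<close>
  have "h (t [True]) = {}"
  proof -
    have "\<not> t (u @ [False]) \<subseteq> t [True]" for u
      using t_sub[of u "[False]"] t_ne[of "u @ [False]"] t_uniq[of _ "[False]" "[True]"] by fastforce
    then show ?thesis using tD ED by (auto simp: h_def)
  qed
  then have "\<exists>a\<in>F. a \<noteq> {} \<and> h a = {}" using tF t_ne by (intro bexI[of _ "t [True]"]) simp_all
  then show ?thesis using hom onto by (intro bexI[of _ h] conjI subsetI)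
qed

lemma not_hopfian_countable_boolean:
  assumes B: "boolean_mv_algebra B" and inf: "infinite (mv_carrier B)"
    and cnt: "countable (mv_carrier B)"
  shows "\<not> hopfian B"
proof -
  interpret boolean_mv_algebra B by (rule B)
  obtain S F where alg: "algebra (S :: 'a set set) F"
    and sep: "\<And>x y. x \<in> S \<Longrightarrow> y \<in> S \<Longrightarrow> x \<noteq> y \<Longrightarrow> \<exists>b\<in>F. x \<in> b \<and> y \<notin> b"
    and iso: "mv_isomorphic B (set_mv S F)"
    using set_representation[OF cnt] by blast
  then obtain f where "bij_betw f (mv_carrier B) F"
    by (auto simp: mv_isomorphic_def mv_iso_def)
  then have F: "infinite F" "countable F"
    using inf cnt bij_betw_finite by (blast, metis bij_betw_def countable_image)
  \<comment> \<open>The two endomorphism lemmas cover infinitely many and finitely many isolated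
    points. In both cases \<open>a\<close> and the empty set have the same image.\<close>
  obtain h a where h: "h \<in> mv_hom (set_mv S F) (set_mv S F)" "F \<subseteq> h ` F"
    and a: "a \<in> F" "a \<noteq> {}" "h a = {}"
    using shift_endomorphism[OF alg F(2)] tree_endomorphism[OF alg F(2,1) sep] by blast
  have "{} \<in> F" using alg by (simp add: algebra_iff_Un)
  then show ?thesis
    using not_hopfian_isomorphicI[OF mv_algebra_axioms iso h(1), of a "{}"] h a mv_homD(2)[OF h(1)]
    by simp
qed

theorem theorem5p4:
  shows "(\<forall>(X :: 'x set) (F :: 'f mv).
            infinite X \<and> mv_algebra F \<and> mv_isomorphic F (mv_free X) \<longrightarrow> \<not> hopfian F) \<and>
         (\<forall>P :: 'p mv.
            mv_algebra P \<and> mv_isomorphic P (mv_coprod Chang Chang) \<longrightarrow> \<not> hopfian P) \<and>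
         (\<forall>B :: 'b mv.
            boolean_mv_algebra B \<and> infinite (mv_carrier B) \<and> countable (mv_carrier B)
            \<longrightarrow> \<not> hopfian B)"
  using not_hopfian_free not_hopfian_Chang_coprod not_hopfian_countable_boolean by blast

end
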